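(* Assume full-state feedback at the current time, $H_0=I$. Then the optimal horizon-$N$ predictive control policy factors into purely reactive and feed-forward anticipatory gain matrices, $$u_0^{[N]}=u_{\rm last}+K_{\rm eff}^{[N]}\,r_0+\sum_{n=0}^{N}\Lambda_n^{[N]}z_n ,$$ where: 1. the sequence $$K_{\rm eff}^{[N]}=G_{-1}S_0+\sum_{k=1}^{N}G_{k-1}\Phi_{k-1}^\top S_kH_k\prod_{i=0}^{k-1}\Phi_i(I-K_iH_i)$$ converges to the stabilizing LQR gain $K_{\rm lqr}$ as $N\to\infty$; 2. and 3. the sequences $$\Lambda_0^{[N]}=-\sum_{k=1}^{N}G_{k-1}\Phi_{k-1}^\top S_kH_k\Bigl(\prod_{i=1}^{k-1}\Phi_i(I-K_iH_i)\Bigr)\Phi_0,$$ $$\Lambda_k^{[N]}=G_{k-1}\Phi_{k-1}^\top S_k-\sum_{j=k+1}^{N}G_{j-1}\Phi_{j-1}^\top S_jH_j\Bigl(\prod_{i=k+1}^{j-1}\Phi_i(I-K_iH_i)\Bigr)\Phi_kK_k\qquad(1\le k\le N)$$ converge, as $N\to\infty$, to the optimal feed-forward anticipatory gains $\Lambda_0,\Lambda_1,\dots$, such that the control contribution resulting from the $n$-th target $z_n$ is $u_{a,n}=\Lambda_nz_n$.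
   Context: System: $x_k=Ax_{k-1}+Bu_{k-1}$, linear time-invariant, $n$ states, $m$ controls. Put $\eta=n+m$, $\chi_k=\begin{bmatrix}x_k\\ u_k\end{bmatrix}\in\mathbb{R}^\eta$, $\Phi=\begin{bmatrix}A&B\\0&I_m\end{bmatrix}$; $\Phi_k=\Phi$ for $k\ge0$ and by convention $\Phi_{-1}=I$. $H_0=I_\eta$, and $H_k=H$ for $k\ge1$ is the measurement matrix selecting the penalized combinations ($H=I_\eta$ if all states and controls are penalized); $z_k$ are target measurements; $\grave R_k$ are symmetric positive definite ($\grave R_k$ constant for $k\ge1$; when $H=I_\eta$, $\grave R_k=\grave R$ is the inverse of the LQR weight $\begin{bmatrix}Q_{\rm lqr}&M_{\rm lqr}\\ M_{\rm lqr}^\top&R_{\rm lqr}\end{bmatrix}$ for all $k$); $\grave Q=\begin{bmatrix}0&0\\0&\tilde R^{-1}\end{bmatrix}$ with $\tilde R\in\mathbb{R}^{m\times m}$ symmetric positive definite. Observed control runs a Kalman filter from $\chi_{0(-)}=\begin{bmatrix}\hat x\\ u_{\rm last}\end{bmatrix}$ (current state, previously applied control), $P_{0(-)}=\grave Q$: for $k\ge0$, $$S_k=H_k^\top(H_kP_{k(-)}H_k^\top+\grave R_k)^{-1},\ K_k=P_{k(-)}S_k,\ r_k=z_k-H_k\chi_{k(-)},\ \chi_{k(+)}=\chi_{k(-)}+K_kr_k,$$ $$P_{k(+)}=(I-K_kH_k)P_{k(-)},\ \chi_{k+1(-)}=\Phi_k\chi_{k(+)},\ P_{k+1(-)}=\Phi_kP_{k(+)}\Phi_k^\top+\grave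 Q,$$ with $G_{-1}=\begin{bmatrix}0&I_m\end{bmatrix}P_{0(-)}$ and $G_k=G_{k-1}\Phi_{k-1}^\top(I-K_kH_k)^\top$. The horizon-$N$ control (control part of the smoothed state at time $0$) is $$u_0^{[N]}=u_{0(+)}+\sum_{k=1}^NG_{k-1}\Phi_{k-1}^\top S_kr_k,$$ $u_{0(+)}$ being the control part of $\chi_{0(+)}$. Ordered products: $\prod_{i=a}^{b}\Phi_i(I-K_iH_i)$ means $\Phi_b(I-K_bH_b)\cdots\Phi_a(I-K_aH_a)$ (later indices on the left), and equals $I$ if $b<a$. The associated infinite-horizon LQR problem is to minimize $\sum_{k\ge0}\bigl(\|z_k-H_k\chi_k\|^2_{\grave R_k^{-1}}+\|u_k-u_{k-1}\|^2_{\tilde R}\bigr)$ subject to the dynamics, $x_0=\hat x$, $u_{-1}=u_{\rm last}$ (with $\|v\|_W^2=v^\top Wv$). $K_{\rm lqr}\in\mathbb{R}^{m\times\eta}$ is its stabilizing feedback gain (assumed to exist): for zero targets the optimal first control is $u_0=u_{\rm last}+K_{\rm lqr}r_0$ with $r_0=-\chi_{0(-)}$. The optimal feed-forward gains $\Lambda_n$ are the coefficients of $z_n$ when the optimal first control is written as $u_0=u_{\rm last}+K_{\rm lqr}r_0+\sum_{n\ge0}\Lambda_nz_n$ with $r_0=z_0-\chi_{0(-)}$. *)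

theory Defs
  imports "HOL-Analysis.Analysis"
begin

definition stack :: "real^'n::finite \<Rightarrow> real^'m::finite \<Rightarrow> real^('n + 'm)" where
  "stack x u = (\<chi> i. case i of Inl a \<Rightarrow> x $ a | Inr b \<Rightarrow> u $ b)"

definition block_mat ::
  "real^'n::finite^'n \<Rightarrow> real^'m::finite^'n \<Rightarrow> real^'n^'m \<Rightarrow> real^'m^'m \<Rightarrow> real^('n + 'm)^('n + 'm)" where
  "block_mat M11 M12 M21 M22 = (\<chi> i j.
     case i of
       Inl a \<Rightarrow> (case j of Inl b \<Rightarrow> M11 $ a $ b | Inr b \<Rightarrow> M12 $ a $ b)
     | Inr a \<Rightarrow> (case j of Inl b \<Rightarrow> M21 $ a $ b | Inr b \<Rightarrow> M22 $ a $ b))"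

definition ctrl_sel :: "real^('n::finite + 'm::finite)^'m" where
  "ctrl_sel = (\<chi> a j. case j of Inl _ \<Rightarrow> 0 | Inr b \<Rightarrow> (if a = b then 1 else 0))"

definition ctrl_part :: "real^('n::finite + 'm::finite) \<Rightarrow> real^'m" where
  "ctrl_part v = (\<chi> b. v $ Inr b)"

definition spd :: "real^'a^'a \<Rightarrow> bool" where
  "spd M \<longleftrightarrow> transpose M = M \<and> (\<forall>x. x \<noteq> 0 \<longrightarrow> 0 < x \<bullet> (M *v x))"

definition wnorm2 :: "real^'a^'a \<Rightarrow> real^'a \<Rightarrow> real" where
  "wnorm2 W v = v \<bullet> (W *v v)"

text \<open>\<open>oprod F a b\<close> is the product of the \<open>F i\<close> over \<open>a \<le> i < b\<close>, later indices on the left.\<close>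

primrec oprod :: "(nat \<Rightarrow> real^'a^'a) \<Rightarrow> nat \<Rightarrow> nat \<Rightarrow> real^'a^'a" where
  "oprod F a 0 = mat 1"
| "oprod F a (Suc b) = (if a \<le> b then F b ** oprod F a b else mat 1)"

text \<open>
  The measurement at time \<open>0\<close> is the full vector (\<open>H\<^sub>0 = I\<close>), the later ones are taken with
  \<open>Hm\<close>. The two have different numbers of rows, so everything indexed by measurements comes in
  two parts: a separate object for time \<open>0\<close> (\<open>Rg0\<close>, \<open>z0\<close>, \<open>S_0\<close>, \<open>K_0\<close>, ...), and a sequence that
  is only meaningful, and only ever used, at indices \<open>k \<ge> 1\<close>. \<open>Rg0\<close> and \<open>Rg\<close> are the
  measurement covariances, i.e. the inverses of the weights in the cost; \<open>Rt\<close> is itself the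
  weight of the control increments.
\<close>

record ('n, 'm, 'p) lqr_data =
  Am :: "real^('n::finite)^'n"
  Bm :: "real^('m::finite)^'n"
  Hm :: "real^('n + 'm)^('p::finite)"
  Rg0 :: "real^('n + 'm)^('n + 'm)"
  Rg :: "real^'p^'p"
  Rt :: "real^'m^'m"

definition Phi :: "('n::finite, 'm::finite, 'p::finite) lqr_data \<Rightarrow> real^('n + 'm)^('n + 'm)" where
  "Phi D = block_mat (Am D) (Bm D) 0 (mat 1)"

definition Qg :: "('n::finite, 'm::finite, 'p::finite) lqr_data \<Rightarrow> real^('n + 'm)^('n + 'm)" where
  "Qg D = block_mat 0 0 0 (matrix_inv (Rt D))"

definition meas_gain :: "real^'a^'q \<Rightarrow> real^'q^'q \<Rightarrow> real^'a^'a \<Rightarrow> real^'q^'a" where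
  "meas_gain H R P = transpose H ** matrix_inv (H ** P ** transpose H + R)"

definition cov_update :: "real^'a^'q \<Rightarrow> real^'q^'q \<Rightarrow> real^'a^'a \<Rightarrow> real^'a^'a" where
  "cov_update H R P = (mat 1 - (P ** meas_gain H R P) ** H) ** P"

primrec P_minus ::
  "('n::finite, 'm::finite, 'p::finite) lqr_data \<Rightarrow> nat \<Rightarrow> real^('n + 'm)^('n + 'm)" where
  "P_minus D 0 = Qg D"
| "P_minus D (Suc k) =
     Phi D ** (if k = 0 then cov_update (mat 1) (Rg0 D) (P_minus D k)
               else cov_update (Hm D) (Rg D) (P_minus D k)) ** transpose (Phi D) + Qg D"

definition S_0 :: "('n::finite, 'm::finite, 'p::finite) lqr_data \<Rightarrow> real^('n + 'm)^('n + 'm)" where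
  "S_0 D = meas_gain (mat 1) (Rg0 D) (P_minus D 0)"

definition S_k :: "('n::finite, 'm::finite, 'p::finite) lqr_data \<Rightarrow> nat \<Rightarrow> real^'p^('n + 'm)" where
  "S_k D k = meas_gain (Hm D) (Rg D) (P_minus D k)"

definition K_0 :: "('n::finite, 'm::finite, 'p::finite) lqr_data \<Rightarrow> real^('n + 'm)^('n + 'm)" where
  "K_0 D = P_minus D 0 ** S_0 D"

definition K_k :: "('n::finite, 'm::finite, 'p::finite) lqr_data \<Rightarrow> nat \<Rightarrow> real^'p^('n + 'm)" where
  "K_k D k = P_minus D k ** S_k D k"

definition IKH ::
  "('n::finite, 'm::finite, 'p::finite) lqr_data \<Rightarrow> nat \<Rightarrow> real^('n + 'm)^('n + 'm)" where
  "IKH D k = (if k = 0 then mat 1 - K_0 D else mat 1 - K_k D k ** Hm D)"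

definition chi0 :: "real^'n::finite \<Rightarrow> real^'m::finite \<Rightarrow> real^('n + 'm)" where
  "chi0 xhat ulast = stack xhat ulast"

definition r_0 :: "real^'n::finite \<Rightarrow> real^'m::finite \<Rightarrow> real^('n + 'm) \<Rightarrow> real^('n + 'm)" where
  "r_0 xhat ulast z0 = z0 - chi0 xhat ulast"

primrec chi_minus ::
  "('n::finite, 'm::finite, 'p::finite) lqr_data \<Rightarrow> real^'n \<Rightarrow> real^'m \<Rightarrow>
   real^('n + 'm) \<Rightarrow> (nat \<Rightarrow> real^'p) \<Rightarrow> nat \<Rightarrow> real^('n + 'm)" where
  "chi_minus D xhat ulast z0 z 0 = chi0 xhat ulast"
| "chi_minus D xhat ulast z0 z (Suc k) =
     (let c = chi_minus D xhat ulast z0 z k in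
      Phi D *v (if k = 0 then c + K_0 D *v (z0 - c)
                else c + K_k D k *v (z k - Hm D *v c)))"

definition r_k ::
  "('n::finite, 'm::finite, 'p::finite) lqr_data \<Rightarrow> real^'n \<Rightarrow> real^'m \<Rightarrow>
   real^('n + 'm) \<Rightarrow> (nat \<Rightarrow> real^'p) \<Rightarrow> nat \<Rightarrow> real^'p" where
  "r_k D xhat ulast z0 z k = z k - Hm D *v chi_minus D xhat ulast z0 z k"

definition chi0_plus ::
  "('n::finite, 'm::finite, 'p::finite) lqr_data \<Rightarrow> real^'n \<Rightarrow> real^'m \<Rightarrow>
   real^('n + 'm) \<Rightarrow> real^('n + 'm)" where
  "chi0_plus D xhat ulast z0 = chi0 xhat ulast + K_0 D *v r_0 xhat ulast z0"

text \<open>Indices shifted by one: \<open>Phi_pre D k\<close> is \<open>\<Phi>\<^sub>k\<^sub>-\<^sub>1\<close> and \<open>G_pre D k\<close> is \<open>G\<^sub>k\<^sub>-\<^sub>1\<close>.\<close>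

definition Phi_pre ::
  "('n::finite, 'm::finite, 'p::finite) lqr_data \<Rightarrow> nat \<Rightarrow> real^('n + 'm)^('n + 'm)" where
  "Phi_pre D k = (if k = 0 then mat 1 else Phi D)"

primrec G_pre ::
  "('n::finite, 'm::finite, 'p::finite) lqr_data \<Rightarrow> nat \<Rightarrow> real^('n + 'm)^'m" where
  "G_pre D 0 = ctrl_sel ** P_minus D 0"
| "G_pre D (Suc k) = G_pre D k ** transpose (Phi_pre D k) ** transpose (IKH D k)"

definition u0_horizon ::
  "('n::finite, 'm::finite, 'p::finite) lqr_data \<Rightarrow> nat \<Rightarrow> real^'n \<Rightarrow> real^'m \<Rightarrow>
   real^('n + 'm) \<Rightarrow> (nat \<Rightarrow> real^'p) \<Rightarrow> real^'m" where
  "u0_horizon D N xhat ulast z0 z =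
     ctrl_part (chi0_plus D xhat ulast z0) +
     (\<Sum>k=1..N. (G_pre D k ** transpose (Phi_pre D k) ** S_k D k) *v r_k D xhat ulast z0 z k)"

definition K_eff ::
  "('n::finite, 'm::finite, 'p::finite) lqr_data \<Rightarrow> nat \<Rightarrow> real^('n + 'm)^'m" where
  "K_eff D N = G_pre D 0 ** S_0 D +
     (\<Sum>k=1..N. G_pre D k ** transpose (Phi_pre D k) ** S_k D k ** Hm D **
                oprod (\<lambda>i. Phi D ** IKH D i) 0 k)"

definition Lambda0_N ::
  "('n::finite, 'm::finite, 'p::finite) lqr_data \<Rightarrow> nat \<Rightarrow> real^('n + 'm)^'m" where
  "Lambda0_N D N =
     - (\<Sum>k=1..N. G_pre D k ** transpose (Phi_pre D k) ** S_k D k ** Hm D **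
                  oprod (\<lambda>i. Phi D ** IKH D i) 1 k ** Phi D)"

definition Lambda_N ::
  "('n::finite, 'm::finite, 'p::finite) lqr_data \<Rightarrow> nat \<Rightarrow> nat \<Rightarrow> real^'p^'m" where
  "Lambda_N D N k =
     G_pre D k ** transpose (Phi_pre D k) ** S_k D k -
     (\<Sum>j=k+1..N. G_pre D j ** transpose (Phi_pre D j) ** S_k D j ** Hm D **
                  oprod (\<lambda>i. Phi D ** IKH D i) (k + 1) j ** Phi D ** K_k D k)"

primrec traj ::
  "('n::finite, 'm::finite, 'p::finite) lqr_data \<Rightarrow> real^'n \<Rightarrow> (nat \<Rightarrow> real^'m) \<Rightarrow> nat \<Rightarrow> real^'n" where
  "traj D xhat u 0 = xhat"
| "traj D xhat u (Suc k) = Am D *v traj D xhat u k + Bm D *v u k"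

definition chi_traj ::
  "('n::finite, 'm::finite, 'p::finite) lqr_data \<Rightarrow> real^'n \<Rightarrow> (nat \<Rightarrow> real^'m) \<Rightarrow>
   nat \<Rightarrow> real^('n + 'm)" where
  "chi_traj D xhat u k = stack (traj D xhat u k) (u k)"

definition stage_cost ::
  "('n::finite, 'm::finite, 'p::finite) lqr_data \<Rightarrow> real^'n \<Rightarrow> real^'m \<Rightarrow>
   real^('n + 'm) \<Rightarrow> (nat \<Rightarrow> real^'p) \<Rightarrow> (nat \<Rightarrow> real^'m) \<Rightarrow> nat \<Rightarrow> real" where
  "stage_cost D xhat ulast z0 z u k =
     (if k = 0 then wnorm2 (matrix_inv (Rg0 D)) (z0 - chi_traj D xhat u 0)
                    + wnorm2 (Rt D) (u 0 - ulast)
      else wnorm2 (matrix_inv (Rg D)) (z k - Hm D *v chi_traj D xhat u k)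
           + wnorm2 (Rt D) (u k - u (k - 1)))"

text \<open>The stage costs are nonnegative, so a control sequence has finite cost iff they are summable.\<close>

definition lqr_optimal ::
  "('n::finite, 'm::finite, 'p::finite) lqr_data \<Rightarrow> real^'n \<Rightarrow> real^'m \<Rightarrow>
   real^('n + 'm) \<Rightarrow> (nat \<Rightarrow> real^'p) \<Rightarrow> (nat \<Rightarrow> real^'m) \<Rightarrow> bool" where
  "lqr_optimal D xhat ulast z0 z u \<longleftrightarrow>
     summable (stage_cost D xhat ulast z0 z u) \<and>
     (\<forall>v. summable (stage_cost D xhat ulast z0 z v) \<longrightarrow>
        (\<Sum>k. stage_cost D xhat ulast z0 z u k) \<le> (\<Sum>k. stage_cost D xhat ulast z0 z v k))"

text \<open>
  \<open>Kl\<close> gives the optimal first control for zero targets, and the optimal control is stabilizing: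
  it drives states and controls to zero. Only the first-step gain is constrained, because the
  weight at time \<open>0\<close> may differ from the later ones; if they agree, then by time invariance
  \<open>Kl\<close> acts at every step and convergence to zero is asymptotic stability of its closed loop.
\<close>

definition stabilizing_lqr_gain ::
  "('n::finite, 'm::finite, 'p::finite) lqr_data \<Rightarrow> real^('n + 'm)^'m \<Rightarrow> bool" where
  "stabilizing_lqr_gain D Kl \<longleftrightarrow>
     (\<forall>xhat ulast.
        (\<exists>u. lqr_optimal D xhat ulast 0 (\<lambda>_. 0) u) \<and>
        (\<forall>u. lqr_optimal D xhat ulast 0 (\<lambda>_. 0) u \<longrightarrow>
           u 0 = ulast + Kl *v r_0 xhat ulast 0 \<and> chi_traj D xhat u \<longlonglongrightarrow> 0))"

text \<open>
  The targets range over the square-summable sequences, for which the optimal cost is finite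
  as soon as it is finite for zero targets (for, say, a constant target it is in general infinite).
  These include every single nonzero target, so the coefficients are uniquely determined.
\<close>

definition optimal_ff_gains ::
  "('n::finite, 'm::finite, 'p::finite) lqr_data \<Rightarrow> real^('n + 'm)^'m \<Rightarrow>
   real^('n + 'm)^'m \<Rightarrow> (nat \<Rightarrow> real^'p^'m) \<Rightarrow> bool" where
  "optimal_ff_gains D Kl L0 L \<longleftrightarrow>
     (\<forall>xhat ulast z0 z. summable (\<lambda>k. (norm (z k))\<^sup>2) \<longrightarrow>
        (\<exists>u. lqr_optimal D xhat ulast z0 z u) \<and>
        (\<forall>u. lqr_optimal D xhat ulast z0 z u \<longrightarrow>
           summable (\<lambda>n. L (Suc n) *v z (Suc n)) \<and>
           u 0 = ulast + Kl *v r_0 xhat ulast z0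
                 + (L0 *v z0 + (\<Sum>n. L (Suc n) *v z (Suc n)))))"

end

theory Submission
  imports Defs
begin

text \<open>
  The factorization follows by unrolling the filter recursion. For the limits no Riccati theory is
  needed. With the backward costates \<open>\<lambda>\<^sub>k\<close> of the fixed-interval smoother, \<open>\<chi>\<^sub>k\<^sub>(\<^sub>-\<^sub>) + P\<^sub>k\<^sub>(\<^sub>-\<^sub>) \<lambda>\<^sub>k\<close>
  satisfies the dynamics and the stationarity conditions of the cost \<open>J\<^sub>N\<close> truncated after stage
  \<open>N\<close>. Hence its control part \<open>u\<^sup>N\<close>, whose first entry is the horizon-\<open>N\<close> control, satisfies
  \<open>J\<^sub>N(v) = J\<^sub>N(u\<^sup>N) + Q\<^sub>N(v - u\<^sup>N)\<close>, where \<open>Q\<^sub>N\<close> is the truncated cost with zero data.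
  The minima \<open>J\<^sub>N(u\<^sup>N)\<close> increase and are bounded by the cost of any control of finite cost, so
  \<open>Q\<^sub>N(u\<^sup>M - u\<^sup>N) \<le> J\<^sub>M(u\<^sup>M) - J\<^sub>N(u\<^sup>N)\<close> makes \<open>u\<^sup>N\<close> a Cauchy sequence stage by stage. Its limit
  is optimal, and every optimal control has the same first entry. All the gains converge by testing
  this on zero targets and on single nonzero targets. Finally, a tail of the targets moves the
  first control by at most the square root of its energy, so the feed-forward series converges for
  all square-summable targets.
\<close>

subsection \<open>Matrices and quadratic forms\<close>

declare transpose_matrix_vector [simp del]

lemmas matvec_simps =
  matrix_vector_right_distrib matrix_vector_mult_diff_distrib
  matrix_vector_mult_add_rdistrib matrix_vector_mult_diff_rdistrib
  matrix_vector_mul_assoc [symmetric]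

lemma inner_matvec: "x \<bullet> (A *v y) = (transpose A *v x) \<bullet> (y :: real^'n)"
  by (simp add: transpose_matrix_vector dot_lmul_matrix)

lemma matvec_neg: "A *v (- x) = - (A *v (x :: real^'n))"
  using matrix_vector_mult_diff_distrib[of A 0 x] by simp

lemma neg_matvec: "(- A) *v x = - (A *v (x :: real^'n))"
  using matrix_vector_mult_diff_rdistrib[of 0 A x] by simp

lemma sum_matvec: "(\<Sum>i\<in>I. A i) *v (x :: real^'n) = (\<Sum>i\<in>I. A i *v x)"
  by (induction I rule: infinite_finite_induct) (simp_all add: matrix_vector_mult_add_rdistrib)

lemma matvec_tendsto: "(f \<longlongrightarrow> l) F \<Longrightarrow> ((\<lambda>i. A *v f i) \<longlongrightarrow> A *v (l :: real^'n)) F"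
  by (rule bounded_linear.tendsto[OF matrix_vector_mul_bounded_linear])

lemma matrix_entry_matvec: "A $ i $ j = (A *v axis j 1) $ (i :: 'm)" for A :: "real^'n^'m"
  by (simp add: matrix_vector_mult_basis column_def)

text \<open>Entries are coordinates of the images of basis vectors. Limits of gains can thus be
  found from their action on one data vector at a time.\<close>

lemma matrix_tendsto_iff:
  fixes A :: "nat \<Rightarrow> real^'n^'m"
  shows "A \<longlonglongrightarrow> L \<longleftrightarrow> (\<forall>x. (\<lambda>N. A N *v x) \<longlonglongrightarrow> L *v x)"
proof
  assume "A \<longlonglongrightarrow> L"
  then show "\<forall>x. (\<lambda>N. A N *v x) \<longlonglongrightarrow> L *v x"
    unfolding matrix_vector_mult_def by (auto intro!: tendsto_intros)
next
  assume "\<forall>x. (\<lambda>N. A N *v x) \<longlonglongrightarrow> L *v x"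
  then have "(\<lambda>N. (A N *v axis j 1) $ i) \<longlonglongrightarrow> (L *v axis j 1) $ i" for i j
    by (intro tendsto_vec_nth) blast
  then show "A \<longlonglongrightarrow> L"
    by (intro vec_tendstoI) (simp add: matrix_entry_matvec)
qed

lemma matrix_convergent:
  fixes A :: "nat \<Rightarrow> real^'n^'m"
  assumes "\<And>x. convergent (\<lambda>N. A N *v x)"
  shows "convergent A"
proof -
  obtain f where f: "\<And>x. (\<lambda>N. A N *v x) \<longlonglongrightarrow> f x"
    using assms unfolding convergent_def by metis
  have "(\<lambda>N. (A N *v axis j 1) $ i) \<longlonglongrightarrow> f (axis j 1) $ i" for i j
    by (intro tendsto_vec_nth f)
  then have "A \<longlonglongrightarrow> (\<chi> i j. f (axis j 1) $ i)"
    by (intro vec_tendstoI) (simp add: matrix_entry_matvec)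
  then show ?thesis by (rule convergentI)
qed

section \<open>Semidefinite matrices and the squares they weight\<close>

definition psd :: "real^'a^'a \<Rightarrow> bool" where
  "psd M \<longleftrightarrow> transpose M = M \<and> (\<forall>x. 0 \<le> x \<bullet> (M *v x))"

lemma spd_imp_psd: "spd M \<Longrightarrow> psd M"
  unfolding spd_def psd_def by (metis inner_zero_left less_imp_le order_refl)

lemma spd_invertible:
  assumes "spd M" shows "invertible M"
proof -
  have "M *v x = 0 \<Longrightarrow> x = 0" for x
    using assms unfolding spd_def by (metis inner_zero_right less_irrefl)
  then show ?thesis by (simp add: invertible_left_inverse matrix_left_invertible_ker)
qed

lemma matrix_inv_matvec:
  fixes M :: "real^'n^'n"
  assumes "invertible M"
  shows "M *v (matrix_inv M *v x) = x" "matrix_inv M *v (M *v x) = x"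
proof -
  have "M ** matrix_inv M = mat 1 \<and> matrix_inv M ** M = mat 1"
    using assms unfolding invertible_def matrix_inv_def by (rule someI_ex)
  then show "M *v (matrix_inv M *v x) = x" "matrix_inv M *v (M *v x) = x"
    by (simp_all add: matrix_vector_mul_assoc)
qed

lemma spd_matrix_inv:
  assumes "spd M" shows "spd (matrix_inv M)"
proof -
  note inv = matrix_inv_matvec[OF spd_invertible[OF assms]]
  have sym: "transpose M = M" using assms by (simp add: spd_def)
  have "x \<bullet> (matrix_inv M *v y) = (matrix_inv M *v x) \<bullet> y" for x y
    by (metis inv(1) inner_matvec sym)
  then have "(transpose (matrix_inv M) *v x) \<bullet> y = (matrix_inv M *v x) \<bullet> y" for x y
    by (metis inner_matvec)
  then have "transpose (matrix_inv M) *v x = matrix_inv M *v x" for x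
    by (metis vector_eq_rdot)
  moreover have "0 < x \<bullet> (matrix_inv M *v x)" if "x \<noteq> 0" for x
  proof -
    let ?y = "matrix_inv M *v x"
    have "?y \<noteq> 0" using inv(1)[of x] that by auto
    then have "0 < ?y \<bullet> (M *v ?y)" using assms by (simp add: spd_def)
    then show ?thesis by (simp add: inv inner_commute)
  qed
  ultimately show ?thesis by (simp add: spd_def matrix_eq)
qed

lemma wnorm2_nonneg: "psd W \<Longrightarrow> 0 \<le> wnorm2 W v"
  by (simp add: psd_def wnorm2_def)

lemma wnorm2_zero [simp]: "wnorm2 W 0 = 0"
  by (simp add: wnorm2_def)

lemma wnorm2_diff:
  assumes "psd W"
  shows "wnorm2 W (a - b) = wnorm2 W a + wnorm2 W b - 2 * ((W *v a) \<bullet> b)"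
proof -
  have "transpose W = W" using assms by (simp add: psd_def)
  then have "a \<bullet> (W *v b) = (W *v a) \<bullet> b" by (simp add: inner_matvec)
  then show ?thesis
    by (simp add: wnorm2_def matvec_simps inner_diff inner_commute)
qed

lemma wnorm2_minus: "wnorm2 W (- a) = wnorm2 W a"
  by (simp add: wnorm2_def matvec_neg)

lemma wnorm2_add:
  assumes "psd W"
  shows "wnorm2 W (a + b) = wnorm2 W a + wnorm2 W b + 2 * ((W *v a) \<bullet> b)"
  using wnorm2_diff[OF assms, of a "- b"] by (simp add: wnorm2_minus)

text \<open>By the parallelogram law the right side exceeds the left by
  \<open>wnorm2 W (a + b)\<close>.\<close>

lemma wnorm2_diff_le:
  assumes "psd W"
  shows "wnorm2 W (a - b) \<le> 2 * wnorm2 W a + 2 * wnorm2 W b"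
  using wnorm2_diff[OF assms, of a b] wnorm2_add[OF assms, of a b] wnorm2_nonneg[OF assms, of "a + b"]
  by linarith

lemma wnorm2_tendsto: "(f \<longlongrightarrow> l) F \<Longrightarrow> ((\<lambda>i. wnorm2 W (f i)) \<longlongrightarrow> wnorm2 W l) F"
  unfolding wnorm2_def by (intro tendsto_inner matvec_tendsto)

lemma wnorm2_scaleR: "wnorm2 W (c *\<^sub>R v) = c\<^sup>2 * wnorm2 W v"
  by (simp add: wnorm2_def matrix_vector_mult_scaleR power2_eq_square)

lemma wnorm2_upper:
  fixes W :: "real^'a^'a"
  obtains C where "0 \<le> C" "\<And>v. wnorm2 W v \<le> C * (norm v)\<^sup>2"
proof
  show "0 \<le> onorm ((*v) W)" by (rule onorm_pos_le) simp
  fix v :: "real^'a"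
  have "wnorm2 W v \<le> norm v * norm (W *v v)"
    unfolding wnorm2_def by (rule norm_cauchy_schwarz)
  also have "\<dots> \<le> norm v * (onorm ((*v) W) * norm v)"
    by (intro mult_left_mono onorm) simp_all
  finally show "wnorm2 W v \<le> onorm ((*v) W) * (norm v)\<^sup>2"
    by (simp add: power2_eq_square algebra_simps)
qed

text \<open>The constant is the minimum on the compact unit sphere, positive by definiteness;
  scaling extends the bound to all vectors.\<close>

lemma wnorm2_lower:
  fixes W :: "real^'a^'a"
  assumes "spd W"
  obtains c where "0 < c" "\<And>v. c * (norm v)\<^sup>2 \<le> wnorm2 W v"
proof -
  have "continuous_on (sphere 0 1) (wnorm2 W)"
    unfolding continuous_on_def by (intro ballI wnorm2_tendsto tendsto_ident_at)
  moreover have "sphere (0 :: real^'a) 1 \<noteq> {}" by simp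
  ultimately obtain u where u: "u \<in> sphere 0 1" and le: "\<And>y. y \<in> sphere 0 1 \<Longrightarrow> wnorm2 W u \<le> wnorm2 W y"
    using continuous_attains_inf[of "sphere 0 1" "wnorm2 W"] by auto
  have "u \<noteq> 0" using u by auto
  then have "0 < wnorm2 W u" using assms by (simp add: spd_def wnorm2_def)
  moreover have "wnorm2 W u * (norm v)\<^sup>2 \<le> wnorm2 W v" for v
  proof (cases "v = 0")
    case False
    then have "wnorm2 W u \<le> wnorm2 W ((1 / norm v) *\<^sub>R v)" by (intro le) simp
    then show ?thesis using False by (simp add: wnorm2_scaleR power_divide field_simps)
  qed simp
  ultimately show thesis by (rule that)
qed

lemma psd_conjugate:
  assumes "psd P" shows "psd (A ** P ** transpose A)"
proof -
  have "x \<bullet> ((A ** P ** transpose A) *v x) = (transpose A *v x) \<bullet> (P *v (transpose A *v x))" for x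
    by (simp only: inner_matvec[of x A] matvec_simps)
  then show ?thesis
    using assms by (simp add: psd_def matrix_transpose_mul matrix_mul_assoc)
qed

lemma transpose_plus: "transpose (A + B) = transpose A + transpose B"
  by (simp add: vec_eq_iff transpose_def)

lemma transpose_minus: "transpose (A - B) = transpose A - transpose (B :: real^'n^'m)"
  by (simp add: vec_eq_iff transpose_def)

lemma psd_add: "psd A \<Longrightarrow> psd B \<Longrightarrow> psd (A + B)"
  by (simp add: psd_def transpose_plus matvec_simps inner_add_right)

lemma psd_add_spd: "psd A \<Longrightarrow> spd B \<Longrightarrow> spd (A + B)"
  by (simp add: psd_def spd_def transpose_plus matvec_simps inner_add_right add_nonneg_pos)

section \<open>One Kalman measurement update\<close>

context
  fixes H :: "real^'a^'q" and R :: "real^'q^'q" and P :: "real^'a^'a"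
  assumes P: "psd P" and R: "spd R"
begin

private abbreviation "E \<equiv> H ** P ** transpose H + R"
private abbreviation "S \<equiv> meas_gain H R P"

private lemma spd_E: "spd E"
  by (intro psd_add_spd psd_conjugate P R)

private lemma sym_P: "transpose P = P"
  using P by (simp add: psd_def)

private lemma transpose_S: "transpose S = matrix_inv E ** H"
  using spd_matrix_inv[OF spd_E] by (simp add: meas_gain_def matrix_transpose_mul spd_def)

lemma transpose_meas_residual:
  "transpose (mat 1 - P ** S ** H) *v w = w - transpose H *v (matrix_inv E *v (H *v (P *v w)))"
  by (simp add: transpose_minus matrix_transpose_mul transpose_S sym_P matvec_simps)

text \<open>Both sides apply \<open>P - P ** transpose H ** matrix_inv E ** H ** P\<close> to
  \<open>w\<close>. This lets the transposed factor of the costate recursion pass through the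
  covariance.\<close>

lemma meas_residual_symmetric:
  "(mat 1 - P ** S ** H) *v (P *v w) = P *v (transpose (mat 1 - P ** S ** H) *v w)"
  unfolding transpose_meas_residual by (simp add: meas_gain_def matvec_simps)

private lemma matvec_R: "E *v s - H *v (P *v (transpose H *v s)) = R *v s"
  by (simp add: matvec_simps)

text \<open>This is the Joseph form: for \<open>K = P ** S\<close>, the quadratic form of the
  updated covariance is the \<open>P\<close>-square of
  \<open>y = transpose (mat 1 - K ** H) *v x\<close> plus the \<open>R\<close>-square of
  \<open>s = transpose K *v x\<close>.\<close>

lemma psd_cov_update: "psd (cov_update H R P)"
proof -
  have *: "cov_update H R P *v w = P *v (transpose (mat 1 - P ** S ** H) *v w)" for w
    by (simp add: cov_update_def flip: meas_residual_symmetric) (simp add: matvec_simps)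
  have "transpose (cov_update H R P) *v w = cov_update H R P *v w" for w
    unfolding * by (simp add: cov_update_def matrix_transpose_mul sym_P flip: matrix_vector_mul_assoc)
  moreover have "0 \<le> x \<bullet> (cov_update H R P *v x)" for x
  proof -
    define s where "s = matrix_inv E *v (H *v (P *v x))"
    define y where "y = x - transpose H *v s"
    have Es: "E *v s = H *v (P *v x)"
      unfolding s_def by (rule matrix_inv_matvec[OF spd_invertible[OF spd_E]])
    have HPy: "H *v (P *v y) = R *v s"
      using matvec_R[of s] unfolding y_def Es by (simp add: matvec_simps)
    have "x \<bullet> (cov_update H R P *v x) = (y + transpose H *v s) \<bullet> (P *v y)"
      by (simp add: * transpose_meas_residual y_def s_def)
    also have "\<dots> = y \<bullet> (P *v y) + s \<bullet> (R *v s)"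
      by (simp add: inner_add_left HPy[symmetric] inner_matvec[of s])
    also have "\<dots> \<ge> 0"
      using P spd_imp_psd[OF R] by (simp add: psd_def)
    finally show ?thesis .
  qed
  ultimately show ?thesis by (simp add: psd_def matrix_eq)
qed

text \<open>With \<open>l = transpose H *v s + w\<close>, the relation
  \<open>E - H ** P ** transpose H = R\<close> shows that the residual left after the correction
  \<open>P *v l\<close> is \<open>R *v s\<close>. The gain disappears, and the gradient of the
  measurement cost takes its place.\<close>

lemma meas_update_adjoint:
  assumes l: "l = S *v r + transpose (mat 1 - P ** S ** H) *v w"
  shows "l = transpose H *v (matrix_inv R *v (r - H *v (P *v l))) + w"
proof -
  define s where "s = matrix_inv E *v (r - H *v (P *v w))"
  have l': "l = transpose H *v s + w"
    unfolding l transpose_meas_residual s_def by (simp add: meas_gain_def matvec_simps)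
  have Es: "E *v s = r - H *v (P *v w)"
    unfolding s_def by (rule matrix_inv_matvec[OF spd_invertible[OF spd_E]])
  have "r - H *v (P *v l) = R *v s"
    using matvec_R[of s] unfolding l' Es by (simp add: matvec_simps algebra_simps)
  then have "matrix_inv R *v (r - H *v (P *v l)) = s"
    by (simp add: matrix_inv_matvec[OF spd_invertible[OF R]])
  then show ?thesis by (simp add: l')
qed

end

subsection \<open>Factorization of the finite-horizon control\<close>

lemma oprod_Suc: "a \<le> b \<Longrightarrow> oprod F a (Suc b) = F b ** oprod F a b"
  by simp

lemma oprod_same: "oprod F a a = mat 1"
  by (cases a) auto

lemma oprod_Suc_left: "a < b \<Longrightarrow> oprod F a b = oprod F (Suc a) b ** F a"
proof (induction b)
  case (Suc b)
  show ?case
  proof (cases "a = b")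
    case True
    then show ?thesis by (simp add: oprod_same)
  next
    case False
    then show ?thesis using Suc by (simp add: matrix_mul_assoc)
  qed
qed simp

declare oprod.simps(2) [simp del]

lemma P_minus_Suc:
  "P_minus D (Suc k) = Phi D ** (IKH D k ** P_minus D k) ** transpose (Phi D) + Qg D"
  by (simp add: cov_update_def IKH_def K_0_def K_k_def S_0_def S_k_def)

lemma IKH_alt:
  "IKH D k = (if k = 0 then mat 1 - P_minus D 0 ** meas_gain (mat 1) (Rg0 D) (P_minus D 0) ** mat 1
              else mat 1 - P_minus D k ** meas_gain (Hm D) (Rg D) (P_minus D k) ** Hm D)"
  by (simp add: IKH_def K_0_def K_k_def S_0_def S_k_def)

text \<open>The first measurement sees the full state, so the prior is \<open>z0\<close> minus
  \<open>r_0\<close>, and the first update yields \<open>z0\<close> minus \<open>IKH D 0\<close>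
  applied to \<open>r_0\<close>. This separates reaction from anticipation; later steps propagate
  both parts and inject the targets.\<close>

lemma chi_minus_affine:
  "chi_minus D xhat ulast z0 z (Suc k) =
     oprod (\<lambda>i. Phi D ** IKH D i) 1 (Suc k) *v (Phi D *v z0)
     - oprod (\<lambda>i. Phi D ** IKH D i) 0 (Suc k) *v r_0 xhat ulast z0
     + (\<Sum>n=1..k. oprod (\<lambda>i. Phi D ** IKH D i) (n + 1) (Suc k) *v (Phi D *v (K_k D n *v z n)))"
proof (induction k)
  case 0
  have "chi_minus D xhat ulast z0 z (Suc 0) = Phi D *v (z0 - IKH D 0 *v r_0 xhat ulast z0)"
    by (simp add: IKH_def r_0_def Let_def matvec_simps)
  then show ?case
    by (simp add: oprod_Suc_left[of 0] oprod_same[where a = "Suc 0"] matvec_simps)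
next
  case (Suc k)
  let ?F = "\<lambda>i. Phi D ** IKH D i"
  have "chi_minus D xhat ulast z0 z (Suc (Suc k)) =
      ?F (Suc k) *v chi_minus D xhat ulast z0 z (Suc k) + Phi D *v (K_k D (Suc k) *v z (Suc k))"
    by (simp add: IKH_def Let_def matvec_simps)
  also have "?F (Suc k) *v chi_minus D xhat ulast z0 z (Suc k) =
      oprod ?F 1 (Suc (Suc k)) *v (Phi D *v z0)
      - oprod ?F 0 (Suc (Suc k)) *v r_0 xhat ulast z0
      + (\<Sum>n=1..k. oprod ?F (n + 1) (Suc (Suc k)) *v (Phi D *v (K_k D n *v z n)))"
    by (subst Suc.IH) (simp add: oprod_Suc matvec_simps linear_sum[OF matrix_vector_mul_linear, unfolded o_def])
  also have "\<dots> + Phi D *v (K_k D (Suc k) *v z (Suc k)) =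
      oprod ?F 1 (Suc (Suc k)) *v (Phi D *v z0)
      - oprod ?F 0 (Suc (Suc k)) *v r_0 xhat ulast z0
      + (\<Sum>n=1..Suc k. oprod ?F (n + 1) (Suc (Suc k)) *v (Phi D *v (K_k D n *v z n)))"
    by (simp add: oprod_same)
  finally show ?case .
qed

lemma ctrl_sel_matvec: "ctrl_sel *v v = ctrl_part v"
proof -
  have "(\<Sum>j\<in>UNIV. (case j of Inl _ \<Rightarrow> 0 | Inr b \<Rightarrow> if a = b then 1 else 0) * v $ j) = v $ Inr a" for a
  proof -
    have "(\<Sum>j\<in>UNIV. (case j of Inl _ \<Rightarrow> 0 | Inr b \<Rightarrow> if a = b then 1 else 0) * v $ j) =
        (\<Sum>j\<in>UNIV. if j = Inr a then v $ j else 0)"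
      by (intro sum.cong refl) (auto split: sum.splits)
    then show ?thesis by simp
  qed
  then show ?thesis
    by (simp add: ctrl_sel_def ctrl_part_def matrix_vector_mult_def)
qed

lemma ctrl_part_stack [simp]: "ctrl_part (stack x u) = u"
  by (simp add: ctrl_part_def stack_def vec_eq_iff)

lemma ctrl_part_add: "ctrl_part (v + w) = ctrl_part v + ctrl_part w"
  by (simp add: ctrl_part_def vec_eq_iff)

text \<open>Collects, for each target \<open>z n\<close>, the innovations at times
  \<open>k > n\<close> to which it contributes.\<close>

lemma triangular_sum_swap:
  "(\<Sum>k=1..N. \<Sum>n=1..k-1. f k n) = (\<Sum>n=1..N. \<Sum>k=n+1..N. f k n)" for N :: nat
  unfolding sum.Sigma[OF finite_atLeastAtMost ballI[OF finite_atLeastAtMost]]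
  by (rule sum.reindex_bij_witness[of _ "\<lambda>(n, k). (k, n)" "\<lambda>(k, n). (n, k)"]) auto

lemma u0_horizon_factorization:
  "u0_horizon D N xhat ulast z0 z =
     ulast + K_eff D N *v r_0 xhat ulast z0
     + (Lambda0_N D N *v z0 + (\<Sum>n=1..N. Lambda_N D N n *v z n))"
proof -
  let ?F = "\<lambda>i. Phi D ** IKH D i"
  let ?M = "\<lambda>k. G_pre D k ** transpose (Phi_pre D k) ** S_k D k"
  let ?r = "r_0 xhat ulast z0"
  have r_k: "?M k *v r_k D xhat ulast z0 z k =
      ?M k *v z k - (?M k ** Hm D ** oprod ?F 1 k ** Phi D) *v z0
      + (?M k ** Hm D ** oprod ?F 0 k) *v ?r
      - (\<Sum>n=1..k-1. (?M k ** Hm D ** oprod ?F (n + 1) k ** Phi D ** K_k D n) *v z n)"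
    if "k \<in> {1..N}" for k
  proof -
    from that obtain m where k: "k = Suc m" by (cases k) auto
    show ?thesis unfolding k r_k_def chi_minus_affine
      by (simp add: matvec_simps linear_sum[OF matrix_vector_mul_linear, unfolded o_def])
  qed
  have "ctrl_part (chi0_plus D xhat ulast z0) = ulast + (G_pre D 0 ** S_0 D) *v ?r"
    by (simp add: chi0_plus_def chi0_def ctrl_part_add K_0_def matvec_simps ctrl_sel_matvec)
  moreover have "(\<Sum>k=1..N. ?M k *v r_k D xhat ulast z0 z k) =
      (\<Sum>k=1..N. ?M k *v z k) - (\<Sum>k=1..N. (?M k ** Hm D ** oprod ?F 1 k ** Phi D) *v z0)
      + (\<Sum>k=1..N. (?M k ** Hm D ** oprod ?F 0 k) *v ?r)
      - (\<Sum>k=1..N. \<Sum>n=1..k-1. (?M k ** Hm D ** oprod ?F (n + 1) k ** Phi D ** K_k D n) *v z n)"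
    unfolding sum.distrib[symmetric] sum_subtractf[symmetric]
    by (intro sum.cong refl r_k)
  moreover note triangular_sum_swap[where N = N and f = "\<lambda>k n. (?M k ** Hm D ** oprod ?F (n + 1) k ** Phi D ** K_k D n) *v z n"]
  ultimately show ?thesis
    unfolding u0_horizon_def K_eff_def Lambda0_N_def Lambda_N_def
    by (simp add: matrix_vector_mult_add_rdistrib matrix_vector_mult_diff_rdistrib neg_matvec
        sum_matvec sum_subtractf)
qed

subsection \<open>The smoothed trajectory minimizes the truncated cost\<close>

lemma sum_UNIV_Plus:
  fixes f :: "'a::finite + 'b::finite \<Rightarrow> 'c::comm_monoid_add"
  shows "(\<Sum>i\<in>UNIV. f i) = (\<Sum>a\<in>UNIV. f (Inl a)) + (\<Sum>b\<in>UNIV. f (Inr b))"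
  using sum.Plus[of UNIV UNIV f] by (simp add: UNIV_Plus_UNIV)

lemma inner_stack: "stack x u \<bullet> stack y v = x \<bullet> y + u \<bullet> v"
  by (simp add: inner_vec_def stack_def sum_UNIV_Plus)

lemma stack_add: "stack (x + y) (u + v) = stack x u + stack y v"
  by (auto simp: stack_def vec_eq_iff split: sum.splits)

lemma stack_0 [simp]: "stack 0 0 = 0"
  by (auto simp: stack_def vec_eq_iff split: sum.splits)

lemma block_mat_stack:
  "block_mat M11 M12 M21 M22 *v stack x u = stack (M11 *v x + M12 *v u) (M21 *v x + M22 *v u)"
  by (auto simp: vec_eq_iff block_mat_def stack_def matrix_vector_mult_def sum_UNIV_Plus
      split: sum.splits)

lemma stack_surj: obtains x u where "v = stack x u"
proof
  show "v = stack (\<chi> a. v $ Inl a) (\<chi> b. v $ Inr b)"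
    by (auto simp: vec_eq_iff stack_def split: sum.splits)
qed

lemma Phi_stack: "Phi D *v stack x u = stack (Am D *v x + Bm D *v u) u"
  by (simp add: Phi_def block_mat_stack)

lemma ctrl_part_Phi: "ctrl_part (Phi D *v v) = ctrl_part v"
  by (rule stack_surj[of v]) (simp add: Phi_stack)

text \<open>The process noise moves controls only. Hence the smoothed trajectory departs from
  \<open>Phi D\<close> only by control increments and obeys the plant dynamics exactly.\<close>

lemma Qg_matvec: "Qg D *v v = stack 0 (matrix_inv (Rt D) *v ctrl_part v)"
  by (rule stack_surj[of v]) (simp add: Qg_def block_mat_stack)

lemma traj_add: "traj D (x + y) (\<lambda>k. u k + v k) k = traj D x u k + traj D y v k"
  by (induction k) (simp_all add: matvec_simps)

lemma chi_traj_add: "chi_traj D (x + y) (\<lambda>k. u k + v k) k = chi_traj D x u k + chi_traj D y v k"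
  by (simp add: chi_traj_def traj_add stack_add)

lemma chi_traj_Suc:
  "chi_traj D xhat u (Suc k) = Phi D *v chi_traj D xhat u k + stack 0 (u (Suc k) - u k)"
  by (simp add: chi_traj_def Phi_stack flip: stack_add)

lemma transpose_block_mat:
  "transpose (block_mat A B C E) = block_mat (transpose A) (transpose C) (transpose B) (transpose E)"
  by (auto simp: transpose_def block_mat_def vec_eq_iff split: sum.splits)

lemma transpose_0 [simp]: "transpose 0 = 0"
  by (simp add: transpose_def vec_eq_iff)

lemma psd_Qg:
  assumes "spd (Rt D)" shows "psd (Qg D)"
proof -
  have Ri: "psd (matrix_inv (Rt D))"
    by (intro spd_imp_psd spd_matrix_inv assms)
  have "0 \<le> v \<bullet> (Qg D *v v)" for v
    by (rule stack_surj[of v]) (use Ri in \<open>simp add: Qg_matvec inner_stack psd_def\<close>)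
  then show ?thesis
    using Ri by (simp add: psd_def Qg_def transpose_block_mat)
qed

section \<open>Costates and the smoothed trajectory\<close>

definition weighted_innov ::
  "('n::finite, 'm::finite, 'p::finite) lqr_data \<Rightarrow> real^'n \<Rightarrow> real^'m \<Rightarrow>
   real^('n + 'm) \<Rightarrow> (nat \<Rightarrow> real^'p) \<Rightarrow> nat \<Rightarrow> real^('n + 'm)" where
  "weighted_innov D xhat ulast z0 z k =
     (if k = 0 then S_0 D *v r_0 xhat ulast z0 else S_k D k *v r_k D xhat ulast z0 z k)"

text \<open>Minus half the gradient of the measurement cost at time \<open>k\<close>.\<close>

definition score ::
  "('n::finite, 'm::finite, 'p::finite) lqr_data \<Rightarrow>
   real^('n + 'm) \<Rightarrow> (nat \<Rightarrow> real^'p) \<Rightarrow> nat \<Rightarrow> real^('n + 'm) \<Rightarrow> real^('n + 'm)" where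
  "score D z0 z k c =
     (if k = 0 then matrix_inv (Rg0 D) *v (z0 - c)
      else transpose (Hm D) *v (matrix_inv (Rg D) *v (z k - Hm D *v c)))"

text \<open>
  The Bryson-Frazier backward recursion: \<open>\<lambda>\<^sub>k = S\<^sub>k r\<^sub>k + (I - K\<^sub>k H\<^sub>k)\<^sup>T \<Phi>\<^sup>T \<lambda>\<^sub>k\<^sub>+\<^sub>1\<close>
  with \<open>\<lambda>\<^sub>N\<^sub>+\<^sub>1 = 0\<close>.
\<close>

definition costate ::
  "('n::finite, 'm::finite, 'p::finite) lqr_data \<Rightarrow> real^'n \<Rightarrow> real^'m \<Rightarrow>
   real^('n + 'm) \<Rightarrow> (nat \<Rightarrow> real^'p) \<Rightarrow> nat \<Rightarrow> nat \<Rightarrow> real^('n + 'm)" where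
  "costate D xhat ulast z0 z N k =
     foldr (\<lambda>i l. weighted_innov D xhat ulast z0 z i + transpose (IKH D i) *v (transpose (Phi D) *v l))
       [k..<Suc N] 0"

text \<open>The fixed-interval smoother in terms of predicted quantities. No covariance is inverted;
  already \<open>P_minus D 0\<close> is singular.\<close>

definition smoothed ::
  "('n::finite, 'm::finite, 'p::finite) lqr_data \<Rightarrow> real^'n \<Rightarrow> real^'m \<Rightarrow>
   real^('n + 'm) \<Rightarrow> (nat \<Rightarrow> real^'p) \<Rightarrow> nat \<Rightarrow> nat \<Rightarrow> real^('n + 'm)" where
  "smoothed D xhat ulast z0 z N k =
     chi_minus D xhat ulast z0 z k + P_minus D k *v costate D xhat ulast z0 z N k"

lemma chi_minus_Suc:
  "chi_minus D xhat ulast z0 z (Suc k) =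
     Phi D *v (chi_minus D xhat ulast z0 z k + P_minus D k *v weighted_innov D xhat ulast z0 z k)"
  by (simp add: Let_def weighted_innov_def r_k_def r_0_def K_0_def K_k_def matvec_simps)

context
  fixes D :: "('n::finite, 'm::finite, 'p::finite) lqr_data"
  assumes spd_Rg0: "spd (Rg0 D)" and spd_Rg: "spd (Rg D)" and spd_Rt: "spd (Rt D)"
begin

lemma psd_P_minus: "psd (P_minus D k)"
proof (induction k)
  case (Suc k)
  then show ?case
    by (auto intro!: psd_add psd_conjugate psd_cov_update psd_Qg spd_Rg0 spd_Rg spd_Rt)
qed (simp add: psd_Qg spd_Rt)

lemma IKH_P_symmetric: "IKH D k *v (P_minus D k *v w) = P_minus D k *v (transpose (IKH D k) *v w)"
  using meas_residual_symmetric[OF psd_P_minus[of 0] spd_Rg0, of "mat 1" w]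
    meas_residual_symmetric[OF psd_P_minus[of k] spd_Rg, of "Hm D" w]
  unfolding IKH_alt by (cases "k = 0") simp_all

context
  fixes xhat :: "real^'n" and ulast :: "real^'m" and z0 :: "real^('n + 'm)"
    and z :: "nat \<Rightarrow> real^'p" and N :: nat
begin

private abbreviation "lam \<equiv> costate D xhat ulast z0 z N"
private abbreviation "sm \<equiv> smoothed D xhat ulast z0 z N"
private abbreviation "uN \<equiv> \<lambda>k. ctrl_part (sm k)"
private abbreviation "cost \<equiv> stage_cost D xhat ulast z0 z"
private abbreviation "cost0 \<equiv> stage_cost D 0 0 0 (\<lambda>_. 0)"

lemma costate_end: "lam (Suc N) = 0"
  by (simp add: costate_def)

lemma costate_step:
  "k \<le> N \<Longrightarrow> lam k = weighted_innov D xhat ulast z0 z k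
     + transpose (IKH D k) *v (transpose (Phi D) *v lam (Suc k))"
  unfolding costate_def by (subst upt_conv_Cons) simp_all

text \<open>Filter gains and innovations are eliminated: the costate obeys the adjoint equation of
  the cost, with the gradient taken at the smoothed trajectory itself.\<close>

lemma costate_score:
  assumes "k \<le> N"
  shows "lam k = score D z0 z k (sm k) + transpose (Phi D) *v lam (Suc k)"
proof (cases "k = 0")
  case True
  have "lam 0 = transpose (mat 1) *v (matrix_inv (Rg0 D) *v
      (r_0 xhat ulast z0 - mat 1 *v (P_minus D 0 *v lam 0))) + transpose (Phi D) *v lam (Suc 0)"
    using costate_step[of 0]
    by (intro meas_update_adjoint[OF psd_P_minus spd_Rg0]) (simp add: IKH_alt weighted_innov_def S_0_def)
  then show ?thesis
    by (simp add: True score_def smoothed_def r_0_def diff_diff_eq)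
next
  case False
  have "lam k = transpose (Hm D) *v (matrix_inv (Rg D) *v
      (r_k D xhat ulast z0 z k - Hm D *v (P_minus D k *v lam k))) + transpose (Phi D) *v lam (Suc k)"
    using costate_step[OF assms] False
    by (intro meas_update_adjoint[OF psd_P_minus spd_Rg]) (simp add: IKH_alt weighted_innov_def S_k_def)
  then show ?thesis
    using False by (simp add: score_def smoothed_def r_k_def diff_diff_eq matrix_vector_right_distrib)
qed

lemma smoothed_0: "sm 0 = stack xhat ulast + Qg D *v lam 0"
  by (simp add: smoothed_def chi0_def)

text \<open>Symmetry of \<open>IKH D k ** P_minus D k\<close> moves the gain factor from the costate
  recursion into the covariance recursion.\<close>

lemma smoothed_Suc:
  assumes "k \<le> N"
  shows "sm (Suc k) = Phi D *v sm k + Qg D *v lam (Suc k)"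
proof -
  have "P_minus D k *v lam k = P_minus D k *v weighted_innov D xhat ulast z0 z k
      + IKH D k *v (P_minus D k *v (transpose (Phi D) *v lam (Suc k)))"
    by (subst costate_step[OF assms]) (simp add: matvec_simps IKH_P_symmetric)
  then show ?thesis
    unfolding smoothed_def chi_minus_Suc P_minus_Suc by (simp add: matvec_simps add.assoc)
qed

lemma smoothed_chi_traj: "k \<le> N \<Longrightarrow> sm k = chi_traj D xhat uN k"
proof (induction k)
  case 0
  show ?case by (simp add: chi_traj_def smoothed_0 Qg_matvec flip: stack_add)
next
  case (Suc k)
  have "uN (Suc k) = uN k + matrix_inv (Rt D) *v ctrl_part (lam (Suc k))"
    using Suc by (simp add: smoothed_Suc ctrl_part_Phi Qg_matvec ctrl_part_add)
  moreover have "sm (Suc k) = Phi D *v chi_traj D xhat uN k + Qg D *v lam (Suc k)"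
    using Suc smoothed_Suc[of k] by simp
  ultimately show ?case
    by (simp add: chi_traj_Suc Qg_matvec)
qed

lemma smoothed_increment:
  assumes "k \<le> N"
  shows "Rt D *v (uN k - (if k = 0 then ulast else uN (k - 1))) = ctrl_part (lam k)"
proof -
  have "uN k - (if k = 0 then ulast else uN (k - 1)) = matrix_inv (Rt D) *v ctrl_part (lam k)"
  proof (cases k)
    case 0
    then show ?thesis by (simp add: smoothed_0 Qg_matvec ctrl_part_add)
  next
    case (Suc j)
    then show ?thesis
      using assms by (simp add: smoothed_Suc ctrl_part_Phi Qg_matvec ctrl_part_add)
  qed
  then show ?thesis by (simp add: matrix_inv_matvec[OF spd_invertible[OF spd_Rt]])
qed

text \<open>Unrolling the costate from time 0 multiplies the control rows of
  \<open>P_minus D 0\<close> by transposed filter factors; these products are the matrices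
  \<open>G_pre D k\<close>.\<close>

lemma smoothed_control: "uN 0 = u0_horizon D N xhat ulast z0 z"
proof -
  let ?T = "\<lambda>k. G_pre D k ** transpose (Phi_pre D k)"
  have "m \<le> N \<Longrightarrow> ?T 0 *v lam 0 =
      (\<Sum>k\<le>m. ?T k *v weighted_innov D xhat ulast z0 z k) + ?T (Suc m) *v lam (Suc m)" for m
  proof (induction m)
    case 0
    show ?case by (subst costate_step) (simp_all add: Phi_pre_def matvec_simps)
  next
    case (Suc m)
    have "?T (Suc m) *v lam (Suc m) = ?T (Suc m) *v weighted_innov D xhat ulast z0 z (Suc m)
       + ?T (Suc (Suc m)) *v lam (Suc (Suc m))"
      by (subst costate_step[OF Suc.prems]) (simp add: Phi_pre_def matvec_simps)
    then show ?case using Suc by simp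
  qed
  from this[of N] have "ctrl_part (P_minus D 0 *v lam 0) =
      (\<Sum>k\<le>N. ?T k *v weighted_innov D xhat ulast z0 z k)"
    by (simp add: costate_end Phi_pre_def ctrl_sel_matvec flip: matrix_vector_mul_assoc)
  also have "\<dots> = ctrl_part (K_0 D *v r_0 xhat ulast z0)
      + (\<Sum>k=1..N. (?T k ** S_k D k) *v r_k D xhat ulast z0 z k)"
    unfolding atMost_atLeast0 sum.atLeast_Suc_atMost[OF le0]
    by (simp add: weighted_innov_def Phi_pre_def K_0_def ctrl_sel_matvec flip: matrix_vector_mul_assoc)
  finally show ?thesis
    by (simp add: smoothed_def u0_horizon_def chi0_plus_def ctrl_part_add)
qed

text \<open>
  The cross term is a telescoping difference, because the costate equation
  \<open>\<lambda>\<^sub>k = score + \<Phi>\<^sup>T \<lambda>\<^sub>k\<^sub>+\<^sub>1\<close> is adjoint to the dynamics of the perturbation \<open>d\<close>.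
\<close>

lemma stage_cost_expand:
  fixes v :: "nat \<Rightarrow> real^'m"
  assumes k: "k \<le> N"
  defines "d \<equiv> \<lambda>k. v k - uN k"
  defines "e \<equiv> \<lambda>k. if k = 0 then 0 else lam k \<bullet> (Phi D *v chi_traj D 0 d (k - 1))"
  shows "cost v k = cost uN k + cost0 d k + 2 * (e (Suc k) - e k)"
proof -
  have chi: "chi_traj D xhat v j = chi_traj D xhat uN j + chi_traj D 0 d j" for j
    using chi_traj_add[of D xhat 0 uN d j] by (simp add: d_def)
  have W: "psd (matrix_inv (Rg0 D))" "psd (matrix_inv (Rg D))" "psd (Rt D)"
    by (intro spd_imp_psd spd_matrix_inv spd_Rg0 spd_Rg spd_Rt)+
  let ?dd = "d k - (if k = 0 then 0 else d (k - 1))"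
  \<comment> \<open>Perturbations start from state zero and previous control zero, so at time 0 the
    whole vector is an increment.\<close>
  have dd: "chi_traj D 0 d k = (if k = 0 then 0 else Phi D *v chi_traj D 0 d (k - 1)) + stack 0 ?dd"
    by (cases k) (simp_all add: chi_traj_Suc, simp add: chi_traj_def)
  have "lam k \<bullet> stack 0 ?dd = ctrl_part (lam k) \<bullet> ?dd"
    by (rule stack_surj[of "lam k"]) (simp add: inner_stack)
  then have inc: "(Rt D *v (uN k - (if k = 0 then ulast else uN (k - 1)))) \<bullet> ?dd
      = lam k \<bullet> chi_traj D 0 d k - e k"
    unfolding smoothed_increment[OF k] by (subst dd) (simp add: inner_add_right e_def)
  \<comment> \<open>In the expansion, \<open>lam k \<bullet> chi_traj D 0 d k\<close> comes with
    opposite signs from the measurement and the increment, which leaves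
    \<open>e (Suc k) - e k\<close>.\<close>
  have "score D z0 z k (sm k) \<bullet> chi_traj D 0 d k = lam k \<bullet> chi_traj D 0 d k - e (Suc k)"
    using costate_score[OF k] by (simp add: e_def inner_add_left inner_matvec)
  then have sc: "(if k = 0 then (matrix_inv (Rg0 D) *v (z0 - chi_traj D xhat uN 0)) \<bullet> chi_traj D 0 d 0
      else (matrix_inv (Rg D) *v (z k - Hm D *v chi_traj D xhat uN k)) \<bullet> (Hm D *v chi_traj D 0 d k))
      = lam k \<bullet> chi_traj D 0 d k - e (Suc k)"
    using smoothed_chi_traj[OF k] by (simp add: score_def inner_matvec split: if_splits)
  have "v k - (if k = 0 then ulast else v (k - 1)) = (uN k - (if k = 0 then ulast else uN (k - 1))) + ?dd"
    by (simp add: d_def)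
  then have R: "wnorm2 (Rt D) (v k - (if k = 0 then ulast else v (k - 1))) =
      wnorm2 (Rt D) (uN k - (if k = 0 then ulast else uN (k - 1))) + wnorm2 (Rt D) ?dd
      + 2 * (lam k \<bullet> chi_traj D 0 d k - e k)"
    using inc by (simp only: wnorm2_add[OF W(3)])
  show ?thesis
  proof (cases "k = 0")
    case True
    have "wnorm2 (matrix_inv (Rg0 D)) (z0 - chi_traj D xhat v 0) =
      wnorm2 (matrix_inv (Rg0 D)) (z0 - chi_traj D xhat uN 0) + wnorm2 (matrix_inv (Rg0 D)) (0 - chi_traj D 0 d 0)
      - 2 * (lam 0 \<bullet> chi_traj D 0 d 0 - e (Suc 0))"
      using sc True by (simp add: chi diff_diff_eq[symmetric] wnorm2_diff[OF W(1)] wnorm2_minus)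
    then show ?thesis using True R by (simp add: stage_cost_def)
  next
    case False
    have "wnorm2 (matrix_inv (Rg D)) (z k - Hm D *v chi_traj D xhat v k) =
      wnorm2 (matrix_inv (Rg D)) (z k - Hm D *v chi_traj D xhat uN k)
      + wnorm2 (matrix_inv (Rg D)) (0 - Hm D *v chi_traj D 0 d k)
      - 2 * (lam k \<bullet> chi_traj D 0 d k - e (Suc k))"
      using sc False by (simp add: chi diff_diff_eq[symmetric] matrix_vector_right_distrib wnorm2_diff[OF W(2)] wnorm2_minus)
    then show ?thesis using False R by (simp add: stage_cost_def)
  qed
qed

lemma horizon_cost_expand:
  "(\<Sum>k\<le>N. cost v k) = (\<Sum>k\<le>N. cost uN k) + (\<Sum>k\<le>N. cost0 (\<lambda>k. v k - uN k) k)"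
proof -
  define e where "e = (\<lambda>k. if k = 0 then 0
    else lam k \<bullet> (Phi D *v chi_traj D 0 (\<lambda>k. v k - uN k) (k - 1)))"
  have "(\<Sum>k\<le>N. cost v k) = (\<Sum>k\<le>N. cost uN k + cost0 (\<lambda>k. v k - uN k) k + 2 * (e (Suc k) - e k))"
    by (intro sum.cong refl) (subst stage_cost_expand, simp_all add: e_def)
  also have "\<dots> = (\<Sum>k\<le>N. cost uN k) + (\<Sum>k\<le>N. cost0 (\<lambda>k. v k - uN k) k) + 2 * (e (Suc N) - e 0)"
    using sum_lessThan_telescope[of e "Suc N"]
    by (simp only: sum.distrib sum_distrib_left[symmetric] lessThan_Suc_atMost)
  \<comment> \<open>Both ends vanish: \<open>e 0\<close> by definition, \<open>e (Suc N)\<close>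
    because the costate is zero beyond the horizon.\<close>
  finally show ?thesis by (simp add: e_def costate_end)
qed

end

end

subsection \<open>Infinite horizon\<close>

text \<open>A definite square controls the norm, so differences of a convergent sequence make
  \<open>x\<close> Cauchy. The bound is asked only from \<open>k\<close> on, since stage
  \<open>k\<close> enters the truncated cost once the horizon reaches it.\<close>

lemma convergent_of_wnorm2_bound:
  fixes x :: "nat \<Rightarrow> real^'a"
  assumes R: "spd R" and a: "convergent a"
    and le: "\<And>N M. k \<le> N \<Longrightarrow> N \<le> M \<Longrightarrow> wnorm2 R (x M - x N) \<le> a M - a N"
  shows "convergent x"
proof -
  obtain c where c: "0 < c" "\<And>v. c * (norm v)\<^sup>2 \<le> wnorm2 R v"
    using wnorm2_lower[OF R] by blast
  have "Cauchy x"
  proof (rule metric_CauchyI)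
    fix e :: real assume "0 < e"
    with c(1) have "0 < c * e\<^sup>2" by simp
    then obtain K where K: "\<And>m n. K \<le> m \<Longrightarrow> K \<le> n \<Longrightarrow> dist (a m) (a n) < c * e\<^sup>2"
      using metric_CauchyD[OF convergent_Cauchy[OF a]] by blast
    have *: "dist (x m) (x n) < e" if "max k K \<le> n" "n \<le> m" for m n
    proof -
      have "c * (norm (x m - x n))\<^sup>2 \<le> a m - a n"
        using c(2)[of "x m - x n"] le[of n m] that by simp
      also have "\<dots> < c * e\<^sup>2"
        using K[of m n] that by (simp add: dist_real_def)
      finally show ?thesis
        using c(1) \<open>0 < e\<close> by (simp add: dist_norm power_less_imp_less_base)
    qed
    show "\<exists>M. \<forall>m\<ge>M. \<forall>n\<ge>M. dist (x m) (x n) < e"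
    proof (intro exI allI impI)
      fix m n assume "max k K \<le> m" "max k K \<le> n"
      then show "dist (x m) (x n) < e"
        using *[of n m] *[of m n] by (cases "n \<le> m") (simp_all add: dist_commute)
    qed
  qed
  then show ?thesis by (rule Cauchy_convergent)
qed

text \<open>Each stage depends continuously on finitely many controls, so entrywise convergence is
  enough.\<close>

lemma chi_traj_tendsto:
  assumes "\<And>k. (\<lambda>N. u N k) \<longlonglongrightarrow> l k"
  shows "(\<lambda>N. chi_traj D xhat (u N) k) \<longlonglongrightarrow> chi_traj D xhat l k"
proof -
  have traj: "(\<lambda>N. traj D xhat (u N) j) \<longlonglongrightarrow> traj D xhat l j" for j
    by (induction j) (auto intro!: tendsto_add matvec_tendsto assms)
  show ?thesis unfolding chi_traj_def stack_def
    by (auto intro!: tendsto_vec_lambda tendsto_vec_nth traj assms split: sum.splits)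
qed

lemma stage_cost_tendsto:
  assumes "\<And>k. (\<lambda>N. u N k) \<longlonglongrightarrow> l k"
  shows "(\<lambda>N. stage_cost D xhat ulast z0 z (u N) k) \<longlonglongrightarrow> stage_cost D xhat ulast z0 z l k"
  by (cases "k = 0")
    (simp_all add: stage_cost_def,
     (intro tendsto_add wnorm2_tendsto tendsto_diff tendsto_const matvec_tendsto chi_traj_tendsto assms)+)

context
  fixes D :: "('n::finite, 'm::finite, 'p::finite) lqr_data"
  assumes spd_Rg0: "spd (Rg0 D)" and spd_Rg: "spd (Rg D)" and spd_Rt: "spd (Rt D)"
begin

private lemma weights_psd:
  "psd (matrix_inv (Rg0 D))" "psd (matrix_inv (Rg D))" "psd (Rt D)"
  by (intro spd_imp_psd spd_matrix_inv spd_Rg0 spd_Rg spd_Rt)+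

lemma stage_cost_nonneg: "0 \<le> stage_cost D xhat ulast z0 z u k"
  by (simp add: stage_cost_def wnorm2_nonneg weights_psd)

lemma increment_le_stage_cost:
  "wnorm2 (Rt D) (u k - (if k = 0 then ulast else u (k - 1))) \<le> stage_cost D xhat ulast z0 z u k"
  by (simp add: stage_cost_def wnorm2_nonneg weights_psd)

text \<open>All that the limit argument needs from the smoother: an exact expansion about the
  truncated minimizer, and its first entry.\<close>

lemma finite_horizon_minimizer:
  obtains uN where "\<And>v N. (\<Sum>k\<le>N. stage_cost D xhat ulast z0 z v k) =
      (\<Sum>k\<le>N. stage_cost D xhat ulast z0 z (uN N) k)
      + (\<Sum>k\<le>N. stage_cost D 0 0 0 (\<lambda>_. 0) (\<lambda>k. v k - uN N k) k)"
    and "\<And>N. uN N 0 = u0_horizon D N xhat ulast z0 z"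
proof (rule that[of "\<lambda>N k. ctrl_part (smoothed D xhat ulast z0 z N k)"])
  note spd = spd_Rg0 spd_Rg spd_Rt
  show "(\<Sum>k\<le>N. stage_cost D xhat ulast z0 z v k) =
      (\<Sum>k\<le>N. stage_cost D xhat ulast z0 z (\<lambda>k. ctrl_part (smoothed D xhat ulast z0 z N k)) k)
      + (\<Sum>k\<le>N. stage_cost D 0 0 0 (\<lambda>_. 0)
          (\<lambda>k. v k - ctrl_part (smoothed D xhat ulast z0 z N k)) k)" for v N
    by (rule horizon_cost_expand[OF spd])
  show "ctrl_part (smoothed D xhat ulast z0 z N 0) = u0_horizon D N xhat ulast z0 z" for N
    by (rule smoothed_control[OF spd])
qed

lemma optimal_control_limit:
  assumes fin: "summable (stage_cost D xhat ulast z0 z w)"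
  shows "\<exists>u. lqr_optimal D xhat ulast z0 z u"
    and "lqr_optimal D xhat ulast z0 z u \<Longrightarrow> (\<lambda>N. u0_horizon D N xhat ulast z0 z) \<longlonglongrightarrow> u 0"
proof -
  let ?c = "stage_cost D xhat ulast z0 z" and ?q = "stage_cost D 0 0 0 (\<lambda>_. 0)"
  obtain uN where expand: "\<And>v N. (\<Sum>k\<le>N. ?c v k) = (\<Sum>k\<le>N. ?c (uN N) k) + (\<Sum>k\<le>N. ?q (\<lambda>k. v k - uN N k) k)"
    and uN_0: "\<And>N. uN N 0 = u0_horizon D N xhat ulast z0 z"
    by (rule finite_horizon_minimizer[of xhat ulast z0 z]) (rule that)
  define a where "a N = (\<Sum>k\<le>N. ?c (uN N) k)" for N
  have c0_nonneg: "0 \<le> (\<Sum>k\<le>N. ?q v k)" for v N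
    by (intro sum_nonneg stage_cost_nonneg)
  have partial_mono: "(\<Sum>k\<le>N. ?c v k) \<le> (\<Sum>k\<le>M. ?c v k)" if "N \<le> M" for v N M
    using that by (intro sum_mono2) (auto intro: stage_cost_nonneg)
  \<comment> \<open>Stopping \<open>uN M\<close> at horizon \<open>N\<close> costs at most
    \<open>a M\<close>; expanding that cost about \<open>uN N\<close> leaves the gap.\<close>
  have gap: "(\<Sum>k\<le>N. ?q (\<lambda>k. uN M k - uN N k) k) \<le> a M - a N" if "N \<le> M" for N M
    using expand[of "uN M" N] partial_mono[OF that, of "uN M"] by (simp add: a_def)
  have "incseq a"
  proof (rule incseq_SucI)
    show "a N \<le> a (Suc N)" for N
      using gap[of N "Suc N"] c0_nonneg[of "\<lambda>k. uN (Suc N) k - uN N k" N] by simp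
  qed
  have a_le: "a N \<le> (\<Sum>k. ?c v k)" if "summable (?c v)" for v N
  proof -
    have "a N \<le> (\<Sum>k\<le>N. ?c v k)"
      using expand[of v N] c0_nonneg[of _ N] by (simp add: a_def)
    also have "\<dots> \<le> (\<Sum>k. ?c v k)"
      using that by (intro sum_le_suminf) (auto intro: stage_cost_nonneg)
    finally show ?thesis .
  qed
  obtain A where A: "a \<longlonglongrightarrow> A"
    using incseq_convergent[OF \<open>incseq a\<close>] a_le[OF fin] by blast
  then have a_conv: "convergent a" by (rule convergentI)
  \<comment> \<open>The cost controls increments only, so these converge first; the controls follow
    by induction on \<open>k\<close>.\<close>
  have inc_conv: "convergent (\<lambda>N. uN N k - (if k = 0 then 0 else uN N (k - 1)))" for k
  proof (rule convergent_of_wnorm2_bound[OF spd_Rt a_conv])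
    fix N M assume kN: "k \<le> N" and NM: "N \<le> M"
    let ?d = "\<lambda>k. uN M k - uN N k"
    have "uN M k - (if k = 0 then 0 else uN M (k - 1)) - (uN N k - (if k = 0 then 0 else uN N (k - 1)))
        = ?d k - (if k = 0 then 0 else ?d (k - 1))"
      by simp
    also have "wnorm2 (Rt D) \<dots> \<le> ?q ?d k"
      by (rule increment_le_stage_cost)
    also have "\<dots> \<le> (\<Sum>k\<le>N. ?q ?d k)"
      using kN by (intro member_le_sum stage_cost_nonneg) auto
    also have "\<dots> \<le> a M - a N" by (rule gap[OF NM])
    finally show "wnorm2 (Rt D) (uN M k - (if k = 0 then 0 else uN M (k - 1))
        - (uN N k - (if k = 0 then 0 else uN N (k - 1)))) \<le> a M - a N" .
  qed
  have "convergent (\<lambda>N. uN N k)" for k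
  proof (induction k)
    case 0
    then show ?case using inc_conv[of 0] by simp
  next
    case (Suc k)
    then show ?case using convergent_add[OF inc_conv[of "Suc k"] Suc] by simp
  qed
  then obtain l where l: "\<And>k. (\<lambda>N. uN N k) \<longlonglongrightarrow> l k"
    unfolding convergent_def by metis
  \<comment> \<open>For fixed \<open>m\<close>, finitely many stages pass to the limit, and under
    \<open>uN N\<close> they cost at most \<open>a N\<close> once \<open>N \<ge> m\<close>.\<close>
  have l_le: "(\<Sum>k\<le>m. ?c l k) \<le> A" for m
  proof (rule LIMSEQ_le[OF _ A])
    show "(\<lambda>N. \<Sum>k\<le>m. ?c (uN N) k) \<longlonglongrightarrow> (\<Sum>k\<le>m. ?c l k)"
      by (intro tendsto_sum stage_cost_tendsto l)
    show "\<exists>N0. \<forall>N\<ge>N0. (\<Sum>k\<le>m. ?c (uN N) k) \<le> a N"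
      using partial_mono unfolding a_def by blast
  qed
  have summ: "summable (?c l)"
    using l_le by (intro bounded_imp_summable stage_cost_nonneg)
  have "(\<Sum>k. ?c l k) \<le> A"
    using LIMSEQ_le_const2[OF summable_LIMSEQ'[OF summ]] l_le by blast
  moreover have A_le: "A \<le> (\<Sum>k. ?c v k)" if "summable (?c v)" for v
    using LIMSEQ_le_const2[OF A] a_le[OF that] by blast
  ultimately have l_opt: "lqr_optimal D xhat ulast z0 z l"
    using summ unfolding lqr_optimal_def by (meson order_trans)
  then show "\<exists>u. lqr_optimal D xhat ulast z0 z u" by (rule exI[of _ l])
  assume u: "lqr_optimal D xhat ulast z0 z u"
  have "(\<Sum>k. ?c u k) = A"
    using u summ \<open>(\<Sum>k. ?c l k) \<le> A\<close> A_le unfolding lqr_optimal_def by (meson order_antisym order_trans)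
  then have "(\<lambda>N. \<Sum>k\<le>N. ?c u k) \<longlonglongrightarrow> A"
    using u summable_LIMSEQ' unfolding lqr_optimal_def by blast
  \<comment> \<open>The optimal \<open>u\<close> attains \<open>A\<close>, so its excess over the
    truncated minima tends to 0. The excess dominates the first increment of
    \<open>u - uN N\<close>, which forces \<open>u 0 = l 0\<close>.\<close>
  then have lim0: "(\<lambda>N. (\<Sum>k\<le>N. ?c u k) - a N) \<longlonglongrightarrow> 0"
    using tendsto_diff[OF _ A] by fastforce
  have "(\<lambda>N. wnorm2 (Rt D) (u 0 - uN N 0)) \<longlonglongrightarrow> 0"
  proof (rule tendsto_sandwich[OF _ _ tendsto_const lim0])
    have "wnorm2 (Rt D) (u 0 - uN N 0) \<le> (\<Sum>k\<le>N. ?c u k) - a N" for N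
    proof -
      let ?d = "\<lambda>k. u k - uN N k"
      have "wnorm2 (Rt D) (?d 0) \<le> ?q ?d 0"
        using increment_le_stage_cost[of ?d 0 0] by simp
      also have "\<dots> \<le> (\<Sum>k\<le>N. ?q ?d k)"
        by (intro member_le_sum stage_cost_nonneg) auto
      finally show ?thesis using expand[of u N] by (simp add: a_def)
    qed
    then show "\<forall>\<^sub>F N in sequentially. wnorm2 (Rt D) (u 0 - uN N 0) \<le> (\<Sum>k\<le>N. ?c u k) - a N"
      by simp
  qed (simp add: wnorm2_nonneg weights_psd)
  then have "wnorm2 (Rt D) (u 0 - l 0) = 0"
    using wnorm2_tendsto[OF tendsto_diff[OF tendsto_const l[of 0]]] LIMSEQ_unique by blast
  then have "u 0 = l 0"
    using spd_Rt unfolding spd_def wnorm2_def by (metis eq_iff_diff_eq_0 less_irrefl)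
  then show "(\<lambda>N. u0_horizon D N xhat ulast z0 z) \<longlonglongrightarrow> u 0"
    using l[of 0] by (simp add: uN_0)
qed

text \<open>The same control keeps finite cost: from stage 1 on, the new stage cost is at most twice
  the old one plus a multiple of the target energy. A single stage does not affect summability, so
  \<open>z0\<close> is arbitrary.\<close>

lemma summable_cost_of_square_summable:
  assumes fin: "summable (stage_cost D xhat ulast 0 (\<lambda>_. 0) w)"
    and z: "summable (\<lambda>k. (norm (z k))\<^sup>2)"
  shows "summable (stage_cost D xhat ulast z0 z w)"
proof -
  obtain C where C: "0 \<le> C" "\<And>v. wnorm2 (matrix_inv (Rg D)) v \<le> C * (norm v)\<^sup>2"
    by (rule wnorm2_upper[of "matrix_inv (Rg D)"]) (rule that)
  show ?thesis
  proof (rule summable_comparison_test')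
    show "summable (\<lambda>k. 2 * (C * (norm (z k))\<^sup>2) + 2 * stage_cost D xhat ulast 0 (\<lambda>_. 0) w k)"
      by (intro summable_add summable_mult z fin)
    fix k :: nat assume "1 \<le> k"
    then show "norm (stage_cost D xhat ulast z0 z w k) \<le>
        2 * (C * (norm (z k))\<^sup>2) + 2 * stage_cost D xhat ulast 0 (\<lambda>_. 0) w k"
      using wnorm2_diff_le[OF weights_psd(2), of "z k" "Hm D *v chi_traj D xhat w k"] C(2)[of "z k"]
        wnorm2_nonneg[OF weights_psd(3), of "w k - w (k - 1)"] stage_cost_nonneg[of xhat ulast z0 z w k]
      by (simp add: stage_cost_def wnorm2_minus)
  qed
qed

text \<open>Starting at rest, doing nothing costs exactly the right-hand side.\<close>

lemma u0_horizon_energy_bound: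
  "wnorm2 (Rt D) (u0_horizon D N 0 0 0 z) \<le> (\<Sum>k=1..N. wnorm2 (matrix_inv (Rg D)) (z k))"
proof -
  let ?c = "stage_cost D 0 0 0 z" and ?q = "stage_cost D 0 0 0 (\<lambda>_. 0)"
  obtain uN where expand: "\<And>v N. (\<Sum>k\<le>N. ?c v k) = (\<Sum>k\<le>N. ?c (uN N) k) + (\<Sum>k\<le>N. ?q (\<lambda>k. v k - uN N k) k)"
    and uN_0: "\<And>N. uN N 0 = u0_horizon D N 0 0 0 z"
    by (rule finite_horizon_minimizer[of 0 0 0 z]) (rule that)
  have rest: "chi_traj D 0 (\<lambda>_. 0) k = 0" for k
  proof -
    have "traj D 0 (\<lambda>_. 0) k = 0" by (induction k) simp_all
    then show ?thesis by (simp add: chi_traj_def)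
  qed
  have "wnorm2 (Rt D) (uN N 0) \<le> ?c (uN N) 0"
    using increment_le_stage_cost[of "uN N" 0 0] by simp
  also have "\<dots> \<le> (\<Sum>k\<le>N. ?c (uN N) k)"
    by (intro member_le_sum stage_cost_nonneg) auto
  also have "\<dots> \<le> (\<Sum>k\<le>N. ?c (\<lambda>_. 0) k)"
    unfolding expand[of "\<lambda>_. 0" N] by (simp add: sum_nonneg stage_cost_nonneg)
  also have "\<dots> = (\<Sum>k=1..N. wnorm2 (matrix_inv (Rg D)) (z k))"
    unfolding atMost_atLeast0 sum.atLeast_Suc_atMost[OF le0]
    by (simp add: stage_cost_def rest)
  finally show ?thesis by (simp add: uN_0)
qed

text \<open>The horizon limit and the sum over targets are interchanged by an estimate uniform in
  the horizon: without the first \<open>M\<close> targets, the response is bounded by the tail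
  energy.\<close>

lemma ff_series_sums:
  assumes L: "\<And>n. 1 \<le> n \<Longrightarrow> (\<lambda>N. Lambda_N D N n) \<longlonglongrightarrow> L n"
    and z: "summable (\<lambda>k. (norm (z k))\<^sup>2)"
    and f: "(\<lambda>N. u0_horizon D N 0 0 0 z) \<longlonglongrightarrow> f"
  shows "(\<lambda>n. L (Suc n) *v z (Suc n)) sums f"
proof -
  let ?W = "matrix_inv (Rg D)"
  obtain C where C: "0 \<le> C" "\<And>v. wnorm2 ?W v \<le> C * (norm v)\<^sup>2"
    by (rule wnorm2_upper[of ?W]) (rule that)
  obtain c where c: "0 < c" "\<And>v. c * (norm v)\<^sup>2 \<le> wnorm2 (Rt D) v"
    using wnorm2_lower[OF spd_Rt] by blast
  have u0: "u0_horizon D N 0 0 0 y = (\<Sum>n=1..N. Lambda_N D N n *v y n)" for N y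
    unfolding u0_horizon_factorization by (simp add: r_0_def chi0_def)
  have Wz: "summable (\<lambda>k. wnorm2 ?W (z k))"
    by (rule summable_comparison_test'[where g = "\<lambda>k. C * (norm (z k))\<^sup>2"])
      (use C z in \<open>auto simp: wnorm2_nonneg weights_psd intro: summable_mult\<close>)
  define tail where "tail M = (\<Sum>k. wnorm2 ?W (z k)) - (\<Sum>k\<le>M. wnorm2 ?W (z k))" for M
  have "tail \<longlonglongrightarrow> (\<Sum>k. wnorm2 ?W (z k)) - (\<Sum>k. wnorm2 ?W (z k))"
    unfolding tail_def by (intro tendsto_diff tendsto_const summable_LIMSEQ' Wz)
  then have tail: "tail \<longlonglongrightarrow> 0" by simp
  have bound: "wnorm2 (Rt D) (f - (\<Sum>n=1..M. L n *v z n)) \<le> tail M" for M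
  proof (rule LIMSEQ_le_const2)
    show "(\<lambda>N. wnorm2 (Rt D) (u0_horizon D N 0 0 0 z - (\<Sum>n=1..M. Lambda_N D N n *v z n)))
        \<longlonglongrightarrow> wnorm2 (Rt D) (f - (\<Sum>n=1..M. L n *v z n))"
      using L unfolding matrix_tendsto_iff
      by (intro wnorm2_tendsto tendsto_diff f tendsto_sum) auto
    show "\<exists>N0. \<forall>N\<ge>N0. wnorm2 (Rt D) (u0_horizon D N 0 0 0 z - (\<Sum>n=1..M. Lambda_N D N n *v z n)) \<le> tail M"
    proof (intro exI allI impI)
      fix N assume MN: "M \<le> N"
      \<comment> \<open>From rest the response is linear in the targets, so the difference is the
        response to the targets after \<open>M\<close>.\<close>
      define y where "y n = (if n \<le> M then 0 else z n)" for n
      have split: "(\<Sum>n=1..N. g n) = (\<Sum>n=1..M. g n) + (\<Sum>n=M+1..N. g n)" for g :: "nat \<Rightarrow> 'b::comm_monoid_add"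
        using sum.ub_add_nat[of 1 M g "N - M"] MN by simp
      have "u0_horizon D N 0 0 0 y = u0_horizon D N 0 0 0 z - (\<Sum>n=1..M. Lambda_N D N n *v z n)"
        unfolding u0 split by (simp add: y_def)
      then have "wnorm2 (Rt D) (u0_horizon D N 0 0 0 z - (\<Sum>n=1..M. Lambda_N D N n *v z n))
          \<le> (\<Sum>k=1..N. wnorm2 ?W (y k))"
        using u0_horizon_energy_bound[of N y] by simp
      also have "\<dots> = (\<Sum>k=M+1..N. wnorm2 ?W (z k))"
        unfolding split by (simp add: y_def)
      also have "\<dots> = (\<Sum>k\<le>N. wnorm2 ?W (z k)) - (\<Sum>k\<le>M. wnorm2 ?W (z k))"
        unfolding atMost_atLeast0 sum.atLeast_Suc_atMost[OF le0] using split[of "\<lambda>k. wnorm2 ?W (z k)"] by simp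
      also have "\<dots> \<le> tail M"
        unfolding tail_def using Wz
        by (intro diff_right_mono sum_le_suminf) (auto intro: wnorm2_nonneg weights_psd)
      finally show "wnorm2 (Rt D) (u0_horizon D N 0 0 0 z - (\<Sum>n=1..M. Lambda_N D N n *v z n)) \<le> tail M" .
    qed
  qed
  have "(\<lambda>M. (norm (f - (\<Sum>n=1..M. L n *v z n)))\<^sup>2) \<longlonglongrightarrow> 0"
  proof (rule tendsto_sandwich[OF _ _ tendsto_const])
    show "(\<lambda>M. tail M / c) \<longlonglongrightarrow> 0" using tendsto_divide[OF tail tendsto_const, of c] c(1) by simp
    have "(norm (f - (\<Sum>n=1..M. L n *v z n)))\<^sup>2 \<le> tail M / c" for M
      using order_trans[OF c(2) bound[of M]] c(1) by (simp add: field_simps)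
    then show "\<forall>\<^sub>F M in sequentially. (norm (f - (\<Sum>n=1..M. L n *v z n)))\<^sup>2 \<le> tail M / c" by simp
  qed simp
  then have "(\<lambda>M. sqrt ((norm (f - (\<Sum>n=1..M. L n *v z n)))\<^sup>2)) \<longlonglongrightarrow> sqrt 0"
    by (rule tendsto_real_sqrt)
  then have "(\<lambda>M. f - (\<Sum>n=1..M. L n *v z n)) \<longlonglongrightarrow> 0"
    by (simp add: tendsto_norm_zero_iff)
  then have "(\<lambda>M. \<Sum>n=1..M. L n *v z n) \<longlonglongrightarrow> f"
    using tendsto_diff[OF tendsto_const, of _ 0 sequentially f] by fastforce
  moreover have "(\<Sum>n=1..M. L n *v z n) = (\<Sum>n<M. L (Suc n) *v z (Suc n))" for M
    using sum.atLeast1_atMost_eq[of "\<lambda>n. L n *v z n" M] by simp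
  ultimately show ?thesis by (simp add: sums_def)
qed

end

section \<open>Convergence of the gains\<close>

theorem theorem3:
  fixes D :: "('n::finite, 'm::finite, 'p::finite) lqr_data"
    and K_lqr :: "real^('n + 'm)^'m"
  assumes "spd (Rg0 D)" and "spd (Rg D)" and "spd (Rt D)"
    and "stabilizing_lqr_gain D K_lqr"
  shows "(\<forall>N xhat ulast z0 z.
            u0_horizon D N xhat ulast z0 z =
              ulast + K_eff D N *v r_0 xhat ulast z0
              + (Lambda0_N D N *v z0 + (\<Sum>n=1..N. Lambda_N D N n *v z n)))
       \<and> (\<lambda>N. K_eff D N) \<longlonglongrightarrow> K_lqr
       \<and> (\<exists>L0 L. optimal_ff_gains D K_lqr L0 L)
       \<and> (\<forall>L0 L. optimal_ff_gains D K_lqr L0 L \<longrightarrow>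
            (\<lambda>N. Lambda0_N D N) \<longlonglongrightarrow> L0 \<and>
            (\<forall>n\<ge>1. (\<lambda>N. Lambda_N D N n) \<longlonglongrightarrow> L n))"
proof -
  note spd = assms(1-3)
  let ?l2 = "\<lambda>z. summable (\<lambda>k. (norm (z k :: real^'p))\<^sup>2)"
  let ?single = "\<lambda>n x k. if k = n then x else (0 :: real^'p)"
  \<comment> \<open>The LQR assumption provides a control of finite cost for zero targets, which
    serves all square-summable ones.\<close>
  have fin: "\<exists>w. summable (stage_cost D xhat ulast z0 z w)" if "?l2 z" for xhat ulast z0 z
    using assms(4) summable_cost_of_square_summable[OF spd _ that]
    unfolding stabilizing_lqr_gain_def lqr_optimal_def by blast
  have ex: "\<exists>u. lqr_optimal D xhat ulast z0 z u" if "?l2 z" for xhat ulast z0 z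
    using fin[OF that] optimal_control_limit(1)[OF spd] by blast
  have lim: "(\<lambda>N. u0_horizon D N xhat ulast z0 z) \<longlonglongrightarrow> u 0"
    if "?l2 z" "lqr_optimal D xhat ulast z0 z u" for xhat ulast z0 z u
    using fin[OF that(1)] optimal_control_limit(2)[OF spd _ that(2)] by blast
  have conv: "convergent (\<lambda>N. u0_horizon D N xhat ulast z0 z)" if "?l2 z" for xhat ulast z0 z
    using ex[OF that] lim[OF that] convergentI by blast
  have l2_0: "?l2 (\<lambda>_. 0)" by simp
  have l2_single: "?l2 (?single n x)" for n x
    by (rule summable_finite[of "{n}"]) auto
  have r0: "r_0 0 0 z0 = (z0 :: real^('n + 'm))" for z0
    by (simp add: r_0_def chi0_def)

  have K: "(\<lambda>N. K_eff D N) \<longlonglongrightarrow> K_lqr"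
    unfolding matrix_tendsto_iff
  proof
    fix r :: "real^('n + 'm)"
    \<comment> \<open>State and last control are chosen so that zero targets produce the residual
      \<open>r\<close>.\<close>
    obtain x y where xy: "- r = stack x (y :: real^'m)" by (rule stack_surj)
    then have r: "r_0 x y 0 = r" by (simp add: r_0_def chi0_def flip: xy)
    obtain u where u: "lqr_optimal D x y 0 (\<lambda>_. 0) u" using ex[OF l2_0] by blast
    then have "u 0 = y + K_lqr *v r"
      using assms(4) unfolding stabilizing_lqr_gain_def by (metis r)
    then have "(\<lambda>N. y + K_eff D N *v r) \<longlonglongrightarrow> y + K_lqr *v r"
      using lim[OF l2_0 u] by (simp add: u0_horizon_factorization r)
    from tendsto_diff[OF this tendsto_const[of y]]
    show "(\<lambda>N. K_eff D N *v r) \<longlonglongrightarrow> K_lqr *v r" by simp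
  qed
  \<comment> \<open>At rest both the residual and the first target equal \<open>x\<close>, so the
    reactive part is subtracted.\<close>
  have L0_eq: "u0_horizon D N 0 0 x (\<lambda>_. 0) - K_eff D N *v x = Lambda0_N D N *v x" for N x
    by (simp add: u0_horizon_factorization r0)
  have L_eq: "u0_horizon D N 0 0 0 (?single n x) = Lambda_N D N n *v x" if "1 \<le> n" "n \<le> N" for N n x
  proof -
    have "(\<Sum>k=1..N. Lambda_N D N k *v ?single n x k) = (\<Sum>k=1..N. if k = n then Lambda_N D N n *v x else 0)"
      by (intro sum.cong) auto
    then show ?thesis
      using that by (simp add: u0_horizon_factorization r0)
  qed
  \<comment> \<open>The two sequences agree once the horizon reaches time \<open>n\<close>.\<close>
  have L_iff: "(\<lambda>N. Lambda_N D N n *v x) \<longlonglongrightarrow> l \<longleftrightarrow> (\<lambda>N. u0_horizon D N 0 0 0 (?single n x)) \<longlonglongrightarrow> l"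
    if "1 \<le> n" for n x l
    by (intro tendsto_cong eventually_sequentiallyI[of n]) (simp add: L_eq[OF that])

  have "\<exists>L0 L. optimal_ff_gains D K_lqr L0 L"
  proof -
    have "convergent (Lambda0_N D)"
    proof (rule matrix_convergent)
      fix x
      have "convergent (\<lambda>N. K_eff D N *v x)"
        using K by (auto simp: matrix_tendsto_iff convergent_def)
      from convergent_diff[OF conv[OF l2_0, of 0 0 x] this]
      show "convergent (\<lambda>N. Lambda0_N D N *v x)" by (simp add: L0_eq)
    qed
    then obtain L0 where L0: "Lambda0_N D \<longlonglongrightarrow> L0" by (auto simp: convergent_def)
    have "convergent (\<lambda>N. Lambda_N D N n)" if "1 \<le> n" for n
      using conv[OF l2_single] L_iff[OF that]
      by (intro matrix_convergent) (simp add: convergent_def)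
    then obtain L where L: "\<And>n. 1 \<le> n \<Longrightarrow> (\<lambda>N. Lambda_N D N n) \<longlonglongrightarrow> L n"
      unfolding convergent_def by metis
    have "optimal_ff_gains D K_lqr L0 L"
      unfolding optimal_ff_gains_def
    proof (intro allI impI conjI)
      fix xhat ulast z0 and z :: "nat \<Rightarrow> real^'p" assume z: "?l2 z"
      show "\<exists>u. lqr_optimal D xhat ulast z0 z u" by (rule ex[OF z])
      fix u assume u: "lqr_optimal D xhat ulast z0 z u"
      obtain f where f: "(\<lambda>N. u0_horizon D N 0 0 0 z) \<longlonglongrightarrow> f"
        using conv[OF z, of 0 0 0] unfolding convergent_def by blast
      have sums: "(\<lambda>n. L (Suc n) *v z (Suc n)) sums f"
        by (rule ff_series_sums[OF spd L z f])
      then show "summable (\<lambda>n. L (Suc n) *v z (Suc n))" by (rule sums_summable)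
      \<comment> \<open>The control splits into feedback, the first target, and the response from
        rest to the later targets.\<close>
      have "(\<lambda>N. ulast + K_eff D N *v r_0 xhat ulast z0 + (Lambda0_N D N *v z0 + u0_horizon D N 0 0 0 z))
          \<longlonglongrightarrow> ulast + K_lqr *v r_0 xhat ulast z0 + (L0 *v z0 + f)"
        using K L0 f by (intro tendsto_add tendsto_const) (auto simp: matrix_tendsto_iff)
      moreover have "ulast + K_eff D N *v r_0 xhat ulast z0 + (Lambda0_N D N *v z0 + u0_horizon D N 0 0 0 z)
          = u0_horizon D N xhat ulast z0 z" for N
        by (simp add: u0_horizon_factorization r0)
      ultimately show "u 0 = ulast + K_lqr *v r_0 xhat ulast z0
          + (L0 *v z0 + (\<Sum>n. L (Suc n) *v z (Suc n)))"
        using lim[OF z u] sums_unique[OF sums] LIMSEQ_unique by auto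
    qed
    then show ?thesis by blast
  qed
  moreover have "(\<lambda>N. Lambda0_N D N) \<longlonglongrightarrow> L0 \<and> (\<forall>n\<ge>1. (\<lambda>N. Lambda_N D N n) \<longlonglongrightarrow> L n)"
    if opt: "optimal_ff_gains D K_lqr L0 L" for L0 L
  proof
    \<comment> \<open>Starting at rest, zero later targets isolate \<open>L0\<close> after
      subtracting the reactive part, and a single target isolates \<open>L n\<close>; any gains
      satisfying the definition are thus the limits.\<close>
    have val: "(\<lambda>N. u0_horizon D N 0 0 z0 z) \<longlonglongrightarrow> K_lqr *v z0 + (L0 *v z0 + (\<Sum>n. L (Suc n) *v z (Suc n)))"
      if z: "?l2 z" for z0 z
    proof -
      obtain u where u: "lqr_optimal D 0 0 z0 z u" using ex[OF z] by blast
      have "u 0 = 0 + K_lqr *v r_0 0 0 z0 + (L0 *v z0 + (\<Sum>n. L (Suc n) *v z (Suc n)))"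
        using opt z u unfolding optimal_ff_gains_def by blast
      then show ?thesis using lim[OF z u] by (simp add: r0)
    qed
    have "(\<lambda>N. Lambda0_N D N *v x) \<longlonglongrightarrow> L0 *v x" for x
    proof -
      have "(\<lambda>N. K_eff D N *v x) \<longlonglongrightarrow> K_lqr *v x"
        using K by (simp add: matrix_tendsto_iff)
      from tendsto_diff[OF val[OF l2_0, of x] this] show ?thesis by (simp add: L0_eq)
    qed
    then show "(\<lambda>N. Lambda0_N D N) \<longlonglongrightarrow> L0" by (simp add: matrix_tendsto_iff)
    show "\<forall>n\<ge>1. (\<lambda>N. Lambda_N D N n) \<longlonglongrightarrow> L n"
      unfolding matrix_tendsto_iff
    proof (intro allI impI)
      fix n :: nat and x assume n: "1 \<le> n"
      have "(\<lambda>k. L (Suc k) *v ?single n x (Suc k)) = (\<lambda>k. if k = n - 1 then L n *v x else 0)"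
        using n by (auto simp: fun_eq_iff)
      then have "(\<lambda>k. L (Suc k) *v ?single n x (Suc k)) sums (L n *v x)"
        using sums_single[of "n - 1" "\<lambda>_. L n *v x"] by simp
      then show "(\<lambda>N. Lambda_N D N n *v x) \<longlonglongrightarrow> L n *v x"
        using val[OF l2_single[of n x], of 0] n by (simp add: L_iff sums_iff)
    qed
  qed
  ultimately show ?thesis
    using K by (simp add: u0_horizon_factorization)
qed

end
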